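(* Let $k\ge 2$ and $d$ be positive integers. Suppose there exists an algorithm for $\mathsf{(k-1)D\;LWS}$ with rank $d$ running in time $O(n^{k-\varepsilon})$ for some $\varepsilon>0$. Then there exists an algorithm for $\mathsf{kMin\text{-}IP}$ with vectors of dimension $d$ (i.e. $\mathsf{kMin\text{-}IP}_{n,d}$) running in time $O(n^{k-\delta})$ for some $\delta>0$.
   Context: Generalized inner product: $\langle x_1,\ldots,x_m\rangle=\sum_{s=1}^d\prod_{t=1}^m x_t[s]$ for $x_t\in\mathbb{R}^d$. $\mathsf{kMin\text{-}IP}_{n,d}$: given $k$ sets $X_1,\ldots,X_k$ of $n$ vectors each in $\{-W,\ldots,W,\infty\}^d$, compute $\min\langle x_1,\ldots,x_k\rangle$ over $x_t\in X_t$ (equivalently decide, for a given integer $r$, whether some choice has value $\le r$). The problem $\mathsf{mD\;LWS}$ (for a positive integer $m$) of size $n$: given $m$ tensors $w_1,\ldots,w_m:[n]^{m+1}\to\{-W,\ldots,W,\infty\}$, define $T:[n]^m\to\mathbb{Z}\cup\{\infty\}$ by $T[1,\ldots,1]=0$ and otherwise $T[j_1,\ldots,j_m]=\min_{1\le \ell\le m}\min_{1\le i_\ell<j_\ell}\bigl(T[j_1,\ldots,j_{\ell-1},i_\ell,j_{\ell+1},\ldots,j_m]+w_\ell[j_1,\ldots,j_m,i_\ell]\bigr)$; output $T[n,\ldots,n]$. An $(m+1)$-dimensional tensor $w:[n]^{m+1}\to\mathbb{R}$ has rank $d$ if there are vectors $x_{t,i}\in\mathbb{R}^d$ ($t\in[m+1]$,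 $i\in[n]$) with $w[i_1,\ldots,i_{m+1}]=\langle x_{1,i_1},\ldots,x_{m+1,i_{m+1}}\rangle$ for all indices; "$\mathsf{mD\;LWS}$ with rank $d$" means every $w_\ell$ has rank $d$ and is given as input via such vectors. Word-RAM model with word size $\Theta(\log n)$; $W$ fits in a constant number of words. *)

theory Defs
  imports Complex_Main "HOL-Library.Extended_Real" "HOL-Library.Landau_Symbols"
begin

section \<open>Weights and generalized inner products\<close>

text \<open>Weights live in \<^typ>\<open>ereal\<close>; in particular \<open>0 * \<infinity> = 0\<close>, and \<open>z * \<infinity> = - \<infinity>\<close>
  for \<open>z < 0\<close>, and \<open>\<infinity> + (- \<infinity>) = \<infinity>\<close>, so a generalized inner product of vectors with entries
  in \<open>weights W\<close> may be \<open>- \<infinity>\<close>. All index sets \<open>[n]\<close> are \<open>{..<n}\<close>, i.e. the indices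
  \<open>1, \<dots>, n\<close> are shifted to \<open>0, \<dots>, n - 1\<close>.\<close>

definition weights :: "nat \<Rightarrow> ereal set" where
  "weights W = insert \<infinity> ((\<lambda>z::int. ereal (of_int z)) ` {- int W..int W})"

definition gip :: "nat \<Rightarrow> nat \<Rightarrow> (nat \<Rightarrow> nat \<Rightarrow> ereal) \<Rightarrow> ereal" where
  "gip d m x = (\<Sum>s<d. \<Prod>t<m. x t s)"

definition tuples :: "nat \<Rightarrow> nat \<Rightarrow> nat list set" where
  "tuples m n = {js. length js = m \<and> set js \<subseteq> {..<n}}"

section \<open>The two problems\<close>

text \<open>\<open>x t i\<close> is the \<open>i\<close>-th vector of the \<open>t\<close>-th set.\<close>

definition kmin_ip :: "nat \<Rightarrow> nat \<Rightarrow> nat \<Rightarrow> (nat \<Rightarrow> nat \<Rightarrow> nat \<Rightarrow> ereal) \<Rightarrow> ereal" where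
  "kmin_ip k d n x = (MIN is \<in> tuples k n. gip d k (\<lambda>t. x t (is ! t)))"

text \<open>\<open>w l (js @ [i])\<close> is \<open>w\<^sub>l[j\<^sub>1, \<dots>, j\<^sub>m, i]\<close>. A minimum over an empty range of \<open>i\<close> is \<open>\<infinity>\<close>.\<close>

function lws_table :: "(nat \<Rightarrow> nat list \<Rightarrow> ereal) \<Rightarrow> nat list \<Rightarrow> ereal" where
  "lws_table w js =
     (if \<forall>j \<in> set js. j = 0 then 0
      else (INF l \<in> {..<length js}. INF i \<in> {..<js ! l}.
              lws_table w (js[l := i]) + w l (js @ [i])))"
  by pat_completeness auto
termination
proof (relation "measure (\<lambda>(w, js). sum_list js)")
  fix w :: "nat \<Rightarrow> nat list \<Rightarrow> ereal" and js :: "nat list" and l i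
  assume "l \<in> {..<length js}" and "i \<in> {..<js ! l}"
  then have l: "l < length js" and i: "i < js ! l" by auto
  have "js ! l \<le> sum_list js"
    using l by (simp add: elem_le_sum_list)
  then have "sum_list (js[l := i]) < sum_list js"
    using l i by (simp add: sum_list_update)
  then show "((w, js[l := i]), (w, js)) \<in> measure (\<lambda>(w, js). sum_list js)"
    by simp
qed simp

declare lws_table.simps [simp del]

definition lws :: "nat \<Rightarrow> nat \<Rightarrow> (nat \<Rightarrow> nat list \<Rightarrow> ereal) \<Rightarrow> ereal" where
  "lws m n w = lws_table w (replicate m (n - 1))"

definition rank_factors ::
    "nat \<Rightarrow> nat \<Rightarrow> nat \<Rightarrow> (nat list \<Rightarrow> ereal) \<Rightarrow> (nat \<Rightarrow> nat \<Rightarrow> nat \<Rightarrow> ereal) \<Rightarrow> bool" where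
  "rank_factors M n d w x \<longleftrightarrow> (\<forall>is \<in> tuples M n. w is = gip d M (\<lambda>t. x t (is ! t)))"

section \<open>The word RAM\<close>

text \<open>A word is a natural number below \<open>2 ^ w\<close>. Registers and memory cells hold words; only
  \<open>Load\<close> and \<open>Store\<close> access the memory, with the address taken from a register. The machine halts
  when the program counter leaves the program. Every instruction takes unit time.\<close>

datatype binop = Add | Sub | Mul | Div | Mod | And | Or | Xor | Shl | Shr

fun apply_op :: "nat \<Rightarrow> binop \<Rightarrow> nat \<Rightarrow> nat \<Rightarrow> nat" where
  "apply_op w Add x y = (x + y) mod 2 ^ w"
| "apply_op w Sub x y = (x + (2 ^ w - y)) mod 2 ^ w"
| "apply_op w Mul x y = (x * y) mod 2 ^ w"
| "apply_op w Div x y = x div y"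
| "apply_op w Mod x y = x mod y"
| "apply_op w And x y = Bit_Operations.and x y"
| "apply_op w Or x y = Bit_Operations.or x y"
| "apply_op w Xor x y = Bit_Operations.xor x y"
| "apply_op w Shl x y = push_bit y x mod 2 ^ w"
| "apply_op w Shr x y = drop_bit y x"

datatype instr =
    Const nat nat            \<comment> \<open>register, constant\<close>
  | Move nat nat             \<comment> \<open>target register, source register\<close>
  | Op binop nat nat nat     \<comment> \<open>target register, operand registers\<close>
  | Load nat nat             \<comment> \<open>target register, register holding the address\<close>
  | Store nat nat            \<comment> \<open>register holding the address, source register\<close>
  | Jmp nat
  | JmpEq nat nat nat        \<comment> \<open>compared registers, jump target\<close>
  | JmpLess nat nat nat      \<comment> \<open>compared registers, jump target\<close>

record state =
  pc :: nat
  regs :: "nat \<Rightarrow> nat"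
  mem :: "nat \<Rightarrow> nat"

fun exec :: "nat \<Rightarrow> instr \<Rightarrow> state \<Rightarrow> state" where
  "exec w (Const r c) \<sigma> = \<sigma>\<lparr>pc := pc \<sigma> + 1, regs := (regs \<sigma>)(r := c mod 2 ^ w)\<rparr>"
| "exec w (Move r a) \<sigma> = \<sigma>\<lparr>pc := pc \<sigma> + 1, regs := (regs \<sigma>)(r := regs \<sigma> a)\<rparr>"
| "exec w (Op f r a b) \<sigma> =
     \<sigma>\<lparr>pc := pc \<sigma> + 1, regs := (regs \<sigma>)(r := apply_op w f (regs \<sigma> a) (regs \<sigma> b))\<rparr>"
| "exec w (Load r a) \<sigma> = \<sigma>\<lparr>pc := pc \<sigma> + 1, regs := (regs \<sigma>)(r := mem \<sigma> (regs \<sigma> a))\<rparr>"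
| "exec w (Store a r) \<sigma> = \<sigma>\<lparr>pc := pc \<sigma> + 1, mem := (mem \<sigma>)(regs \<sigma> a := regs \<sigma> r)\<rparr>"
| "exec w (Jmp p) \<sigma> = \<sigma>\<lparr>pc := p\<rparr>"
| "exec w (JmpEq a b p) \<sigma> = \<sigma>\<lparr>pc := (if regs \<sigma> a = regs \<sigma> b then p else pc \<sigma> + 1)\<rparr>"
| "exec w (JmpLess a b p) \<sigma> = \<sigma>\<lparr>pc := (if regs \<sigma> a < regs \<sigma> b then p else pc \<sigma> + 1)\<rparr>"

definition halted :: "instr list \<Rightarrow> state \<Rightarrow> bool" where
  "halted P \<sigma> \<longleftrightarrow> length P \<le> pc \<sigma>"

definition step :: "nat \<Rightarrow> instr list \<Rightarrow> state \<Rightarrow> state" where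
  "step w P \<sigma> = (if halted P \<sigma> then \<sigma> else exec w (P ! pc \<sigma>) \<sigma>)"

definition init :: "nat \<Rightarrow> (nat \<Rightarrow> nat) \<Rightarrow> state" where
  "init n M = \<lparr>pc = 0, regs = (\<lambda>_. 0)(0 := n), mem = M\<rparr>"

section \<open>Representation of inputs and outputs\<close>

text \<open>A number occupies \<open>c + 1\<close> cells: a tag for its sign or for an infinite value, and \<open>c\<close> words
  with the base \<open>2 ^ w\<close> digits of its absolute value, least significant first.\<close>

definition stored_at :: "nat \<Rightarrow> nat \<Rightarrow> (nat \<Rightarrow> nat) \<Rightarrow> nat \<Rightarrow> ereal \<Rightarrow> bool" where
  "stored_at c w M a v \<longleftrightarrow>
     (\<exists>z::int. v = ereal (of_int z) \<and> M a = (if z < 0 then 1 else 0) \<and>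
        nat \<bar>z\<bar> = (\<Sum>i<c. M (a + 1 + i) * 2 ^ (w * i))) \<or>
     v = \<infinity> \<and> M a = 2 \<or>
     v = - \<infinity> \<and> M a = 3"

text \<open>\<open>M\<close> is a memory whose first \<open>b\<close> cells are the input and whose other cells are zero.\<close>

definition input_memory :: "nat \<Rightarrow> nat \<Rightarrow> (nat \<Rightarrow> nat) \<Rightarrow> bool" where
  "input_memory w b M \<longleftrightarrow> (\<forall>a. M a < 2 ^ w) \<and> (\<forall>a\<ge>b. M a = 0)"

text \<open>A problem relates a size \<open>n\<close>, a word size \<open>w\<close>, a memory encoding an instance of size \<open>n\<close>,
  and the value to be computed for that instance. In the two problems below the bound \<open>W\<close> on the
  weights fits in \<open>c\<close> words.\<close>

type_synonym problem = "nat \<Rightarrow> nat \<Rightarrow> (nat \<Rightarrow> nat) \<Rightarrow> ereal \<Rightarrow> bool"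

definition kmin_ip_problem :: "nat \<Rightarrow> nat \<Rightarrow> nat \<Rightarrow> problem" where
  "kmin_ip_problem k d c n w M v \<longleftrightarrow>
     (\<exists>W x. W < 2 ^ (c * w) \<and>
        (\<forall>t<k. \<forall>i<n. \<forall>s<d. x t i s \<in> weights W \<and>
           stored_at c w M (((t * n + i) * d + s) * (c + 1)) (x t i s)) \<and>
        input_memory w (k * n * d * (c + 1)) M \<and>
        v = kmin_ip k d n x)"

text \<open>The factors of the tensors range over the same set as the vectors of \<^const>\<open>kmin_ip\<close>: an
  infinite tensor entry needs an infinite factor.\<close>

definition lws_rank_problem :: "nat \<Rightarrow> nat \<Rightarrow> nat \<Rightarrow> problem" where
  "lws_rank_problem m d c n w M v \<longleftrightarrow>
     (\<exists>W ws x. W < 2 ^ (c * w) \<and>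
        (\<forall>l<m. \<forall>js \<in> tuples (m + 1) n. ws l js \<in> weights W) \<and>
        (\<forall>l<m. rank_factors (m + 1) n d (ws l) (x l)) \<and>
        (\<forall>l<m. \<forall>t<m + 1. \<forall>i<n. \<forall>s<d. x l t i s \<in> weights W \<and>
           stored_at c w M ((((l * (m + 1) + t) * n + i) * d + s) * (c + 1)) (x l t i s)) \<and>
        input_memory w (m * (m + 1) * n * d * (c + 1)) M \<and>
        v = lws m n ws)"

text \<open>Word size \<open>\<Theta>(log n)\<close>: the program works for every word size from some multiple
  \<open>c\<^sub>0\<close> of \<open>log n\<close> on (\<open>n\<close> must be a word and the input must be addressable), and for every upper bound
  \<open>C log n\<close> on the word size there is a running time bound in \<open>O(n\<^sup>a)\<close>. The logarithm is taken
  of \<open>n + 1\<close> so that it does not vanish for \<open>n = 1\<close>. The output is written to address \<open>0\<close>, in a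
  constant number \<open>q\<close> of words.\<close>

definition has_algorithm :: "problem \<Rightarrow> real \<Rightarrow> bool" where
  "has_algorithm prob a \<longleftrightarrow>
     (\<exists>P q. \<exists>c\<^sub>0\<ge>1. \<forall>C. \<exists>T :: nat \<Rightarrow> nat.
        (\<lambda>n. real (T n)) \<in> O(\<lambda>n. real n powr a) \<and>
        (\<forall>n\<ge>1. \<forall>w. c\<^sub>0 * log 2 (real n + 1) \<le> real w \<and> real w \<le> C * log 2 (real n + 1) \<longrightarrow>
           (\<forall>M v. prob n w M v \<longrightarrow>
              (let \<sigma> = (step w P ^^ T n) (init n M)
               in halted P \<sigma> \<and> stored_at q w (mem \<sigma>) 0 v))))"

end

theory Submission
  imports Defs
begin

text \<open>Put \<open>m = k - 1\<close> and take tables of side \<open>2 n\<close>. Only the first weight tensor is nonzero, and it is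
  nonzero only for moves along the first axis from the half \<open>{..<n}\<close> to the half \<open>{n..<2 n}\<close>: moving
  from \<open>i\<close> to \<open>j\<^sub>1\<close> at \<open>j\<^sub>2, \<dots>, j\<^sub>m\<close> costs the inner product of the vectors \<open>j\<^sub>1, \<dots>, j\<^sub>m, i\<close> (indices
  modulo \<open>n\<close>) of the \<open>k\<close> sets. Zero factors switch the other entries off, so the rank stays \<open>d\<close>.
  A path crosses between the halves exactly once and moves freely before and after, so the final table
  entry is the minimal inner product.

  The weights of an LWS instance may not be \<open>- \<infinity>\<close>, but inner products may. Whether \<open>- \<infinity>\<close> is
  attained depends only on which of the constantly many sign patterns occur in each of the sets, so this
  case is recognized in linear time beforehand.\<close>

section \<open>The reduction\<close>

text \<open>Coordinates of an LWS path only grow, so splitting the range of the first one into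
  halves forces a single crossing; the free moves set the other coordinates to an arbitrary choice
  before it and raise everything to the corner after it. The obstacle is arithmetic with mixed
  signs: \<open>(- 1) * \<infinity> = - \<infinity>\<close> is not a legal tensor entry. It can be
  overcome because being infinite is a matter of five sign classes, and because indices in different
  sets are independent, so that knowing which patterns occur in each set separately is enough. The
  remaining effort is to have a concrete machine do this within linear time. The instance is
  expanded in place, since input and output both start at address 0. Numbers are widened, since an
  inner product can be as large as \<open>d * W ^ k\<close>; this is why the algorithm for LWS is
  invoked with another number of words. Finally the given program has to be started in a state that
  looks exactly like a fresh one.\<close>

definition cross_factor ::
    "nat \<Rightarrow> nat \<Rightarrow> (nat \<Rightarrow> nat \<Rightarrow> nat \<Rightarrow> ereal) \<Rightarrow> nat \<Rightarrow> nat \<Rightarrow> nat \<Rightarrow> nat \<Rightarrow> ereal" where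
  "cross_factor m n x l t i s =
     (if l \<noteq> 0 \<or> t = 0 \<and> i < n \<or> t = m \<and> n \<le> i then 0 else x t (i mod n) s)"

definition cross_weight ::
    "nat \<Rightarrow> nat \<Rightarrow> nat \<Rightarrow> (nat \<Rightarrow> nat \<Rightarrow> nat \<Rightarrow> ereal) \<Rightarrow> nat \<Rightarrow> nat list \<Rightarrow> ereal" where
  "cross_weight m n d x l js = gip d (m + 1) (\<lambda>t. cross_factor m n x l t (js ! t))"

text \<open>In \<open>ereal\<close> the product \<open>0 * \<infinity>\<close> is \<open>0\<close>,
  so a zero vector annihilates infinite entries of the other vectors too. This is how weights are
  switched off without raising the rank.\<close>

lemma gip_eq_0: "t < m \<Longrightarrow> (\<And>s. s < d \<Longrightarrow> x t s = 0) \<Longrightarrow> gip d m x = 0"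
  unfolding gip_def by (intro sum.neutral ballI) (auto simp: prod_ereal_0)

lemma gip_cong:
  "(\<And>t s. t < m \<Longrightarrow> s < d \<Longrightarrow> x t s = y t s) \<Longrightarrow> gip d m x = gip d m y"
  unfolding gip_def by (intro sum.cong prod.cong) auto

lemma cross_weight_eq_0:
  assumes "l \<noteq> 0 \<or> js ! 0 < n \<or> n \<le> js ! m"
  shows "cross_weight m n d x l js = 0"
proof -
  consider "l \<noteq> 0" | "js ! 0 < n" | "n \<le> js ! m" using assms by blast
  then show ?thesis unfolding cross_weight_def
    by cases (rule gip_eq_0[of 0] gip_eq_0[of m]; simp add: cross_factor_def)+
qed

lemma cross_weight_crossing:
  assumes "n \<le> js ! 0" "js ! m < n" "length js = m + 1"
  shows "cross_weight m n d x 0 js = gip d (m + 1) (\<lambda>t. x t (map (\<lambda>i. i mod n) js ! t))"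
  unfolding cross_weight_def
  using assms by (intro gip_cong) (auto simp: cross_factor_def)

lemma map_mod_tuples: "0 < n \<Longrightarrow> length js = m \<Longrightarrow> map (\<lambda>i. i mod n) js \<in> tuples m n"
  by (auto simp: tuples_def)

lemma finite_tuples [simp]: "finite (tuples m n)"
  using finite_lists_length_eq[of "{..<n}" m] by (simp add: tuples_def conj_commute)

lemma tuples_nth: "js \<in> tuples m n \<Longrightarrow> t < m \<Longrightarrow> js ! t < n"
  by (auto simp: tuples_def subset_iff)

lemma tuples_nonempty: "0 < n \<Longrightarrow> tuples m n \<noteq> {}"
  using map_mod_tuples[of n "replicate m 0" m] by auto

lemma tuples_update: "js \<in> tuples m n \<Longrightarrow> i < n \<Longrightarrow> js[l := i] \<in> tuples m n"
  using set_update_subset_insert[of js l i] by (auto simp: tuples_def)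

section \<open>Bounds on the table of the constructed instance\<close>

lemma lws_table_le:
  assumes "l < length js" "i < js ! l"
  shows "lws_table w js \<le> lws_table w (js[l := i]) + w l (js @ [i])"
proof -
  have "js ! l \<in> set js" "js ! l \<noteq> 0" using assms by auto
  then have "lws_table w js = (INF l \<in> {..<length js}. INF i \<in> {..<js ! l}.
              lws_table w (js[l := i]) + w l (js @ [i]))"
    by (subst lws_table.simps) auto
  also have "\<dots> \<le> lws_table w (js[l := i]) + w l (js @ [i])"
    using assms by (intro INF_lower2[of l] INF_lower2[of i]) auto
  finally show ?thesis .
qed

lemma lws_table_ge:
  assumes "\<exists>j\<in>set js. j \<noteq> 0"
    and "\<And>l i. l < length js \<Longrightarrow> i < js ! l \<Longrightarrow> V \<le> lws_table w (js[l := i]) + w l (js @ [i])"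
  shows "V \<le> lws_table w js"
  using assms by (subst lws_table.simps) (auto intro!: INF_greatest)

text \<open>Both bounds are proved in one induction on the coordinate sum, since a cell of the upper
  half has predecessors in both halves. A move within a half has weight zero and inherits the bound;
  a crossing adds a weight of at least \<open>V\<close> to an entry that is at least zero.\<close>

lemma cross_table_lower:
  assumes V: "\<And>is. is \<in> tuples (m + 1) n \<Longrightarrow> V \<le> gip d (m + 1) (\<lambda>t. x t (is ! t))"
    and "0 < m" "0 < n" "js \<in> tuples m (2 * n)"
  shows "(js ! 0 < n \<longrightarrow> 0 \<le> lws_table (cross_weight m n d x) js) \<and>
         (n \<le> js ! 0 \<longrightarrow> V \<le> lws_table (cross_weight m n d x) js)"
  using assms(4)
proof (induction "sum_list js" arbitrary: js rule: less_induct)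
  case less
  let ?T = "lws_table (cross_weight m n d x)"
  have len: "length js = m" using less.prems by (simp add: tuples_def)
  show ?case
  proof (cases "\<forall>j\<in>set js. j = 0")
    case True
    moreover have "js ! 0 \<in> set js" using len assms(2) by simp
    ultimately have "js ! 0 = 0" by blast
    moreover have "?T js = 0" using True by (subst lws_table.simps) simp
    ultimately show ?thesis using assms(3) by simp
  next
    case False
    have IH: "(js[l := i] ! 0 < n \<longrightarrow> 0 \<le> ?T (js[l := i])) \<and>
              (n \<le> js[l := i] ! 0 \<longrightarrow> V \<le> ?T (js[l := i]))" if "l < m" "i < js ! l" for l i
    proof (rule less.hyps)
      have "js ! l \<le> sum_list js" using that len by (simp add: elem_le_sum_list)
      then show "sum_list (js[l := i]) < sum_list js"
        using that len by (simp add: sum_list_update)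
      have "js ! l < 2 * n" using tuples_nth[OF less.prems that(1)] .
      then show "js[l := i] \<in> tuples m (2 * n)"
        using that less.prems by (intro tuples_update) auto
    qed
    have w0: "cross_weight m n d x l (js @ [i]) = 0" if "l \<noteq> 0 \<or> js ! 0 < n \<or> n \<le> i" for l i
      using that len assms(2) by (intro cross_weight_eq_0) (auto simp: nth_append)
    have "0 \<le> ?T js" if "js ! 0 < n"
    proof (rule lws_table_ge)
      fix l i assume l: "l < length js" "i < js ! l"
      have "js[l := i] ! 0 < n" using l that len assms(2) by (cases "l = 0") auto
      then show "0 \<le> ?T (js[l := i]) + cross_weight m n d x l (js @ [i])"
        using IH[of l i] w0 l len that by auto
    qed (use False in auto)
    moreover have "V \<le> ?T js" if ge: "n \<le> js ! 0"
    proof (rule lws_table_ge)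
      fix l i assume l: "l < length js" "i < js ! l"
      show "V \<le> ?T (js[l := i]) + cross_weight m n d x l (js @ [i])"
      proof (cases "l \<noteq> 0 \<or> n \<le> i")
        case True
        then have "n \<le> js[l := i] ! 0" using ge len assms(2) l by (cases "l = 0") auto
        then show ?thesis using IH[of l i] w0[of l i] True l len by auto
      next
        case False
        \<comment> \<open>A move along the first axis from the lower to the upper half, the only
          kind whose weight is not switched off. Reduction modulo \<open>n\<close> exhibits the
          weight as one of the inner products bounded by \<open>V\<close>.\<close>
        have "cross_weight m n d x l (js @ [i]) =
            gip d (m + 1) (\<lambda>t. x t (map (\<lambda>i. i mod n) (js @ [i]) ! t))"
          using False ge len assms(2) cross_weight_crossing[of n "js @ [i]" m d x]
          by (auto simp: nth_append)
        also have "V \<le> \<dots>"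
          by (rule V, rule map_mod_tuples) (use assms(3) len in auto)
        finally have "V \<le> cross_weight m n d x l (js @ [i])" .
        moreover have "0 \<le> ?T (js[l := i])" using False IH[of l i] l len assms(2) by auto
        ultimately show ?thesis using add_mono[of 0 "?T (js[l := i])" V] by simp
      qed
    qed (use False in auto)
    ultimately show ?thesis by blast
  qed
qed

text \<open>While the first coordinate is below \<open>n\<close> every weight is zero. Hence each
  nonzero coordinate can be reached from \<open>0\<close> by one free move, and the value
  \<open>0\<close> of the origin propagates.\<close>

lemma cross_table_start:
  assumes "0 < m" "js \<in> tuples m (2 * n)" "js ! 0 < n"
  shows "lws_table (cross_weight m n d x) js \<le> 0"
  using assms(2,3)
proof (induction "sum_list js" arbitrary: js rule: less_induct)
  case less
  let ?T = "lws_table (cross_weight m n d x)"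
  have len: "length js = m" using less.prems by (simp add: tuples_def)
  show ?case
  proof (cases "\<forall>j\<in>set js. j = 0")
    case True
    then show ?thesis by (subst lws_table.simps) simp
  next
    case False
    then obtain l where l: "l < m" "0 < js ! l" using len by (auto simp: in_set_conv_nth)
    have "js ! l \<le> sum_list js" using l len by (simp add: elem_le_sum_list)
    then have "sum_list (js[l := 0]) < sum_list js" using l len by (simp add: sum_list_update)
    moreover have "js[l := 0] \<in> tuples m (2 * n)" using less.prems by (intro tuples_update) auto
    moreover have "js[l := 0] ! 0 < n" using less.prems len assms(1) by (cases "l = 0") auto
    ultimately have "?T (js[l := 0]) \<le> 0" by (rule less.hyps)
    moreover have "cross_weight m n d x l (js @ [0]) = 0"
      using less.prems len assms(1) by (intro cross_weight_eq_0) (auto simp: nth_append)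
    ultimately show ?thesis using lws_table_le[of l js 0 "cross_weight m n d x"] l len by auto
  qed
qed

text \<open>The move that raises coordinate \<open>l\<close> to \<open>b\<close> starts at
  \<open>js ! l\<close>. On the first axis this start is at least \<open>n\<close>, so the weight is
  switched off; on the other axes all weights are zero.\<close>

lemma cross_table_free_move:
  assumes "length js = m" "l < m" "n \<le> js ! 0" "js ! l \<le> b"
  shows "lws_table (cross_weight m n d x) (js[l := b]) \<le> lws_table (cross_weight m n d x) js"
proof (cases "js ! l = b")
  case True
  then have "js[l := b] = js" by auto
  then show ?thesis by simp
next
  case False
  have "cross_weight m n d x l (js[l := b] @ [js ! l]) = 0"
    using assms by (intro cross_weight_eq_0) (cases "l = 0"; simp add: nth_append)
  then show ?thesis
    using lws_table_le[of l "js[l := b]" "js ! l" "cross_weight m n d x"] assms False by auto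
qed

lemma cross_table_end:
  assumes "js \<in> tuples m (2 * n)" "n \<le> js ! 0" "0 < m"
  shows "lws_table (cross_weight m n d x) (replicate m (2 * n - 1)) \<le> lws_table (cross_weight m n d x) js"
proof -
  let ?T = "lws_table (cross_weight m n d x)"
  have len: "length js = m" using assms by (simp add: tuples_def)
  have lt: "js ! t < 2 * n" if "t < m" for t using tuples_nth[OF assms(1) that] .
  \<comment> \<open>\<open>p\<close> counts the coordinates already raised to the corner.\<close>
  have "?T (replicate p (2 * n - 1) @ drop p js) \<le> ?T js" if "p \<le> m" for p
    using that
  proof (induction p)
    case (Suc p)
    let ?js = "replicate p (2 * n - 1) @ drop p js"
    have "(replicate (Suc p) (2 * n - 1) @ drop (Suc p) js) = ?js[p := 2 * n - 1]"
      using Suc.prems len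
      by (simp add: list_update_append Cons_nth_drop_Suc[symmetric] replicate_append_same)
    moreover have "?T (?js[p := 2 * n - 1]) \<le> ?T ?js"
    proof (rule cross_table_free_move)
      show "n \<le> ?js ! 0" using assms len lt[of 0] by (cases p) auto
      show "?js ! p \<le> 2 * n - 1" using lt[of p] Suc.prems len by (simp add: nth_append)
    qed (use Suc.prems len in auto)
    ultimately show ?case using Suc by auto
  qed simp
  from this[of m] show ?thesis using len by simp
qed

text \<open>The lower bound is the invariant of the upper half with the minimum as \<open>V\<close>.
  For the upper bound, every choice of indices is turned into a path with a single paid
  move.\<close>

theorem lws_cross_weight:
  assumes "0 < m" "0 < n"
  shows "lws m (2 * n) (cross_weight m n d x) = kmin_ip (m + 1) d n x"
proof (rule antisym)
  let ?T = "lws_table (cross_weight m n d x)"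
  have fin: "finite ((\<lambda>is. gip d (m + 1) (\<lambda>t. x t (is ! t))) ` tuples (m + 1) n)" by simp
  have ne: "(\<lambda>is. gip d (m + 1) (\<lambda>t. x t (is ! t))) ` tuples (m + 1) n \<noteq> {}"
    using tuples_nonempty[OF assms(2)] by simp
  have last: "replicate m (2 * n - 1) \<in> tuples m (2 * n)" using assms by (auto simp: tuples_def)
  have "kmin_ip (m + 1) d n x \<le> gip d (m + 1) (\<lambda>t. x t (is ! t))" if "is \<in> tuples (m + 1) n" for "is"
    unfolding kmin_ip_def using that fin by (intro Min_le) auto
  then show "kmin_ip (m + 1) d n x \<le> lws m (2 * n) (cross_weight m n d x)"
    using cross_table_lower[of m n "kmin_ip (m + 1) d n x" d x, OF _ assms last] assms
    by (auto simp: lws_def)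
  show "lws m (2 * n) (cross_weight m n d x) \<le> kmin_ip (m + 1) d n x"
    unfolding kmin_ip_def
  proof (subst Min_ge_iff[OF fin ne], safe)
    fix "is" assume i: "is \<in> tuples (m + 1) n"
    then have len: "length is = m + 1" by (simp add: tuples_def)
    \<comment> \<open>The target of the paid move. Its first coordinate, shifted to the upper half,
      names the vector of the first set; the first coordinate before the move is
      \<open>is ! m\<close> and names the vector of the last set.\<close>
    define js where "js = (take m is)[0 := n + is ! 0]"
    have lj: "length js = m" using len by (simp add: js_def)
    have small: "is ! t < n" if "t \<le> m" for t using tuples_nth[OF i] that by simp
    have nth: "js ! t = (if t = 0 then n + is ! 0 else is ! t)" if "t < m" for t
      using that len by (auto simp: js_def)
    have js: "js \<in> tuples m (2 * n)"
    proof -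
      have "js ! t < 2 * n" if "t < m" for t using nth[OF that] small[of t] small[of 0] that by auto
      then show ?thesis using lj by (auto simp: tuples_def in_set_conv_nth)
    qed
    have "map (\<lambda>i. i mod n) (js @ [is ! m]) = is"
    proof (rule nth_equalityI)
      fix t assume "t < length (map (\<lambda>i. i mod n) (js @ [is ! m]))"
      then have "t \<le> m" using lj by simp
      then show "map (\<lambda>i. i mod n) (js @ [is ! m]) ! t = is ! t"
        using lj nth[of t] small[of t] assms(1) by (cases "t = m") (auto simp: nth_append)
    qed (use lj len in simp)
    then have w: "cross_weight m n d x 0 (js @ [is ! m]) = gip d (m + 1) (\<lambda>t. x t (is ! t))"
      using cross_weight_crossing[of n "js @ [is ! m]" m d x] nth[of 0] lj small[of m] assms(1)
      by (simp add: nth_append)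
    have "?T (replicate m (2 * n - 1)) \<le> ?T js"
      by (rule cross_table_end[OF js]) (use nth[of 0] assms in auto)
    also have "\<dots> \<le> ?T (js[0 := is ! m]) + cross_weight m n d x 0 (js @ [is ! m])"
      by (rule lws_table_le) (use nth[of 0] lj assms(1) small[of m] in auto)
    also have "\<dots> \<le> 0 + cross_weight m n d x 0 (js @ [is ! m])"
      using js small[of m] lj assms(1)
      by (intro add_right_mono cross_table_start tuples_update) auto
    finally show "lws m (2 * n) (cross_weight m n d x) \<le> gip d (m + 1) (\<lambda>t. x t (is ! t))"
      by (simp add: lws_def w)
  qed
qed

section \<open>Sign patterns, weights and encodings\<close>

text \<open>Five classes: the two infinities, negative finite, zero and positive finite. They are
  compatible with products but not with sums, which therefore need an argument of their own.\<close>

definition same_sign :: "ereal \<Rightarrow> ereal \<Rightarrow> bool" where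
  "same_sign x y \<longleftrightarrow> (x < 0 \<longleftrightarrow> y < 0) \<and> (x = 0 \<longleftrightarrow> y = 0) \<and> (x = \<infinity> \<longleftrightarrow> y = \<infinity>) \<and> (x = - \<infinity> \<longleftrightarrow> y = - \<infinity>)"

lemma same_sign_mult: "same_sign a b \<Longrightarrow> same_sign c d \<Longrightarrow> same_sign (a * c) (b * d)"
  unfolding same_sign_def
  by (cases a; cases b; cases c; cases d)
    (auto simp: mult_less_0_iff mult_le_0_iff not_less ereal_mult_infty ereal_infty_mult split: if_splits)

lemma same_sign_prod:
  fixes k :: nat
  shows "(\<And>t. t < k \<Longrightarrow> same_sign (x t) (y t)) \<Longrightarrow> same_sign (\<Prod>t<k. x t) (\<Prod>t<k. y t)"
proof (induction k)
  case 0
  show ?case by (simp add: same_sign_def)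
qed (simp add: same_sign_mult)

text \<open>Since \<open>\<infinity> + (- \<infinity>) = \<infinity>\<close>, a single
  \<open>\<infinity>\<close> absorbs everything, and \<open>- \<infinity>\<close> survives only in
  its absence.\<close>

lemma sum_eq_MInfty:
  fixes f :: "nat \<Rightarrow> ereal"
  shows "(\<Sum>s<d. f s) = - \<infinity> \<longleftrightarrow> (\<exists>s<d. f s = - \<infinity>) \<and> (\<forall>s<d. f s \<noteq> \<infinity>)"
proof (induction d)
  case (Suc d)
  have "(\<Sum>s<d. f s) \<noteq> \<infinity> \<longleftrightarrow> (\<forall>s<d. f s \<noteq> \<infinity>)" by (auto simp: sum_Pinfty)
  then show ?case using Suc by (auto simp: less_Suc_eq ereal_plus_eq_MInfty)
qed simp

lemma gip_MInfty_cong: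
  assumes "\<And>t s. t < k \<Longrightarrow> s < d \<Longrightarrow> same_sign (x t s) (y t s)"
  shows "gip d k x = - \<infinity> \<longleftrightarrow> gip d k y = - \<infinity>"
proof -
  have "same_sign (\<Prod>t<k. x t s) (\<Prod>t<k. y t s)" if "s < d" for s
    using assms that by (intro same_sign_prod) auto
  then have "((\<Prod>t<k. x t s) = - \<infinity> \<longleftrightarrow> (\<Prod>t<k. y t s) = - \<infinity>) \<and>
             ((\<Prod>t<k. x t s) = \<infinity> \<longleftrightarrow> (\<Prod>t<k. y t s) = \<infinity>)" if "s < d" for s
    using that unfolding same_sign_def by auto
  then show ?thesis unfolding gip_def sum_eq_MInfty by auto
qed

section \<open>Sign types of stored vectors\<close>

definition signature :: "nat \<Rightarrow> (nat \<Rightarrow> nat) \<Rightarrow> nat \<Rightarrow> nat" where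
  "signature c M a = 2 * M a + (if \<exists>e<c. M (a + 1 + e) \<noteq> 0 then 1 else 0)"

text \<open>One number for each sign class. A negative number has tag 1 and a nonzero digit, hence
  signature 3; the signature 2 does not arise from a stored number. An entry
  \<open>\<infinity>\<close> yields 4 or 5, because its digit cells are unconstrained.\<close>

definition representative :: "nat \<Rightarrow> ereal" where
  "representative \<sigma> = (if \<sigma> = 0 then 0 else if \<sigma> = 1 then 1 else if \<sigma> < 4 then - 1 else \<infinity>)"

lemma signature_stored_at:
  assumes "stored_at c w M a v" "v \<noteq> - \<infinity>"
  shows "signature c M a < 6" "same_sign (representative (signature c M a)) v"
proof -
  consider z :: int where "v = ereal (of_int z)" "M a = (if z < 0 then 1 else 0)"
      "nat \<bar>z\<bar> = (\<Sum>i<c. M (a + 1 + i) * 2 ^ (w * i))"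
    | "v = \<infinity>" "M a = 2"
    using assms unfolding stored_at_def by auto
  then have "signature c M a < 6 \<and> same_sign (representative (signature c M a)) v"
  proof cases
    case 1
    have "z = 0 \<longleftrightarrow> (\<forall>e<c. M (a + 1 + e) = 0)"
    proof -
      have "z = 0 \<longleftrightarrow> nat \<bar>z\<bar> = 0" by auto
      also have "\<dots> \<longleftrightarrow> (\<forall>e<c. M (a + 1 + e) = 0)" unfolding 1(3) by auto
      finally show ?thesis .
    qed
    moreover have "(- 1 :: ereal) \<noteq> \<infinity>" "(- 1 :: ereal) \<noteq> - \<infinity>" by (simp_all add: one_ereal_def)
    ultimately show ?thesis using 1(1,2)
      by (auto simp: signature_def representative_def same_sign_def zero_ereal_def[symmetric])
  next
    case 2
    then show ?thesis
      by (auto simp: signature_def representative_def same_sign_def)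
  qed
  then show "signature c M a < 6" "same_sign (representative (signature c M a)) v" by auto
qed

text \<open>A numeral in base 6, least significant digit first. It packs the signatures of a vector
  into a number below \<open>6 ^ d\<close>, so the number of types does not depend on
  \<open>n\<close>.\<close>

primrec encode :: "nat \<Rightarrow> (nat \<Rightarrow> nat) \<Rightarrow> nat" where
  "encode 0 \<sigma> = 0"
| "encode (Suc d) \<sigma> = encode d \<sigma> + \<sigma> d * 6 ^ d"

definition decode :: "nat \<Rightarrow> nat \<Rightarrow> nat" where
  "decode \<tau> s = \<tau> div 6 ^ s mod 6"

lemma encode_less: "(\<And>s. s < d \<Longrightarrow> \<sigma> s < 6) \<Longrightarrow> encode d \<sigma> < 6 ^ d"
proof (induction d)
  case (Suc d)
  then have "encode d \<sigma> < 6 ^ d" "\<sigma> d \<le> 5" by (auto simp: less_Suc_eq_le[symmetric])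
  moreover from this(2) have "\<sigma> d * 6 ^ d \<le> 5 * 6 ^ d" by (rule mult_right_mono) simp
  ultimately show ?case unfolding encode.simps power_Suc by linarith
qed simp

lemma decode_encode: "(\<And>s. s < d \<Longrightarrow> \<sigma> s < 6) \<Longrightarrow> s < d \<Longrightarrow> decode (encode d \<sigma>) s = \<sigma> s"
proof (induction d)
  case (Suc d)
  show ?case
  proof (cases "s = d")
    case True
    then show ?thesis using encode_less[of d \<sigma>] Suc.prems by (simp add: decode_def)
  next
    case False
    then have s: "s < d" using Suc.prems by simp
    \<comment> \<open>The new leading digit contributes a multiple of \<open>6 ^ Suc s\<close>,
      which does not affect digit \<open>s\<close>.\<close>
    then have "(6::nat) ^ d = 6 ^ s * (6 * 6 ^ (d - Suc s))"
      by (simp flip: power_Suc power_add add: Suc_diff_Suc)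
    then have "encode (Suc d) \<sigma> = encode d \<sigma> + 6 ^ s * (6 * (\<sigma> d * 6 ^ (d - Suc s)))"
      by (simp only: encode.simps mult.left_commute mult.assoc)
    then have "decode (encode (Suc d) \<sigma>) s = decode (encode d \<sigma>) s"
      by (simp only: decode_def) (simp add: div_mult_self2)
    then show ?thesis using Suc s by auto
  qed
qed simp

definition vector_type :: "nat \<Rightarrow> nat \<Rightarrow> nat \<Rightarrow> (nat \<Rightarrow> nat) \<Rightarrow> nat \<Rightarrow> nat \<Rightarrow> nat" where
  "vector_type d c n M t i =
     encode d (\<lambda>s. signature c M ((t * n + i) * (d * (c + 1)) + s * (c + 1)))"

text \<open>A finite set determined by \<open>k\<close> and \<open>d\<close> alone. It can be built
  into the program, which thus never computes with signs itself.\<close>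

definition bad_types :: "nat \<Rightarrow> nat \<Rightarrow> nat list set" where
  "bad_types k d =
     {\<tau>s \<in> tuples k (6 ^ d). gip d k (\<lambda>t s. representative (decode (\<tau>s ! t) s)) = - \<infinity>}"

lemma vector_type_less_same_sign:
  assumes "\<And>s. s < d \<Longrightarrow> x s \<noteq> - \<infinity> \<and> stored_at c w M (((t * n + i) * d + s) * (c + 1)) (x s)"
  shows "vector_type d c n M t i < 6 ^ d"
    and "s < d \<Longrightarrow> same_sign (representative (decode (vector_type d c n M t i) s)) (x s)"
proof -
  let ?\<sigma> = "\<lambda>s. signature c M ((t * n + i) * (d * (c + 1)) + s * (c + 1))"
  have addr: "((t * n + i) * d + s) * (c + 1) = (t * n + i) * (d * (c + 1)) + s * (c + 1)" for s
    by (simp add: algebra_simps)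
  have \<sigma>: "?\<sigma> s < 6" "same_sign (representative (?\<sigma> s)) (x s)" if "s < d" for s
    using signature_stored_at[of c w M "((t * n + i) * d + s) * (c + 1)" "x s"] assms[OF that]
    unfolding addr by auto
  show "vector_type d c n M t i < 6 ^ d"
    unfolding vector_type_def by (rule encode_less[OF \<sigma>(1)])
  show "same_sign (representative (decode (vector_type d c n M t i) s)) (x s)" if "s < d"
    unfolding vector_type_def using decode_encode[of d ?\<sigma>, OF \<sigma>(1) that] \<sigma>(2)[OF that] by simp
qed

text \<open>The index in each set is chosen independently of the others, so it is enough to know for
  every set which types occur in it. Replacing entries by representatives of their sign class does
  not affect whether an inner product is \<open>- \<infinity>\<close>.\<close>

lemma ex_MInfty_iff_bad_types:
  assumes "\<And>t i s. t < k \<Longrightarrow> i < n \<Longrightarrow> s < d \<Longrightarrow>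
     x t i s \<noteq> - \<infinity> \<and> stored_at c w M (((t * n + i) * d + s) * (c + 1)) (x t i s)"
  shows "(\<exists>is\<in>tuples k n. gip d k (\<lambda>t. x t (is ! t)) = - \<infinity>) \<longleftrightarrow>
     (\<exists>\<tau>s\<in>bad_types k d. \<forall>t<k. \<exists>i<n. vector_type d c n M t i = \<tau>s ! t)"
proof -
  let ?\<tau> = "vector_type d c n M"
  have less: "?\<tau> t i < 6 ^ d" if "t < k" "i < n" for t i
    using vector_type_less_same_sign(1)[of d "x t i"] assms that by blast
  have sgn: "same_sign (representative (decode (?\<tau> t i) s)) (x t i s)" if "t < k" "i < n" "s < d" for t i s
    using vector_type_less_same_sign(2)[of d "x t i"] assms that by blast
  have eq: "gip d k (\<lambda>t. x t (is ! t)) = - \<infinity> \<longleftrightarrow>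
      gip d k (\<lambda>t s. representative (decode (\<tau>s ! t) s)) = - \<infinity>"
    if "is \<in> tuples k n" "\<And>t. t < k \<Longrightarrow> \<tau>s ! t = ?\<tau> t (is ! t)" for "is" \<tau>s
    by (rule gip_MInfty_cong[symmetric]) (use that sgn tuples_nth[OF that(1)] in auto)
  show ?thesis
  proof
    assume "\<exists>is\<in>tuples k n. gip d k (\<lambda>t. x t (is ! t)) = - \<infinity>"
    then obtain "is" where i: "is \<in> tuples k n" "gip d k (\<lambda>t. x t (is ! t)) = - \<infinity>" by blast
    let ?\<tau>s = "map (\<lambda>t. ?\<tau> t (is ! t)) [0..<k]"
    have "?\<tau>s \<in> bad_types k d"
      using i eq[OF i(1), of ?\<tau>s] less tuples_nth[OF i(1)] by (auto simp: bad_types_def tuples_def)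
    then show "\<exists>\<tau>s\<in>bad_types k d. \<forall>t<k. \<exists>i<n. ?\<tau> t i = \<tau>s ! t"
      using tuples_nth[OF i(1)] by (intro bexI[of _ ?\<tau>s]) auto
  next
    assume "\<exists>\<tau>s\<in>bad_types k d. \<forall>t<k. \<exists>i<n. ?\<tau> t i = \<tau>s ! t"
    then obtain \<tau>s where \<tau>s: "\<tau>s \<in> bad_types k d" "\<forall>t<k. \<exists>i<n. ?\<tau> t i = \<tau>s ! t" by blast
    then obtain f where f: "\<forall>t<k. f t < n \<and> ?\<tau> t (f t) = \<tau>s ! t" by metis
    let ?is = "map f [0..<k]"
    have "?is \<in> tuples k n" using f by (auto simp: tuples_def)
    moreover have "gip d k (\<lambda>t. x t (?is ! t)) = - \<infinity>"
      using eq[OF calculation, of \<tau>s] f \<tau>s by (simp add: bad_types_def)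
    ultimately show "\<exists>is\<in>tuples k n. gip d k (\<lambda>t. x t (is ! t)) = - \<infinity>" by blast
  qed
qed

section \<open>Ranges of products, sums and inner products\<close>

lemma weights_iff: "v \<in> weights W \<longleftrightarrow> v = \<infinity> \<or> (\<exists>z::int. v = ereal (of_int z) \<and> \<bar>z\<bar> \<le> int W)"
  by (auto simp: weights_def abs_le_iff)

lemma weights_mono: "v \<in> weights W \<Longrightarrow> W \<le> W' \<Longrightarrow> v \<in> weights W'"
  unfolding weights_iff by force

lemma zero_in_weights [simp]: "0 \<in> weights W"
  unfolding weights_iff by (intro disjI2 exI[of _ 0]) (simp add: zero_ereal_def)

lemma weights_mult:
  assumes "a \<in> insert (- \<infinity>) (weights A)" "b \<in> insert (- \<infinity>) (weights B)"
  shows "a * b \<in> insert (- \<infinity>) (weights (A * B))"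
proof (cases "\<bar>a\<bar> = \<infinity> \<or> \<bar>b\<bar> = \<infinity>")
  case True
  then have "a * b = 0 \<or> a * b = \<infinity> \<or> a * b = - \<infinity>"
    by (cases a; cases b) (auto simp: ereal_mult_infty ereal_infty_mult)
  moreover have "\<infinity> \<in> weights (A * B)" by (simp add: weights_iff)
  ultimately show ?thesis using zero_in_weights by (metis insert_iff)
next
  case False
  then obtain y z :: int where "a = ereal (of_int y)" "\<bar>y\<bar> \<le> int A" "b = ereal (of_int z)" "\<bar>z\<bar> \<le> int B"
    using assms by (auto simp: weights_iff)
  then have "a * b = ereal (of_int (y * z))" "\<bar>y * z\<bar> \<le> int (A * B)"
    by (simp_all add: abs_mult mult_mono)
  then show ?thesis unfolding insert_iff weights_iff by blast
qed

lemma weights_add: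
  assumes "a \<in> insert (- \<infinity>) (weights A)" "b \<in> insert (- \<infinity>) (weights B)"
  shows "a + b \<in> insert (- \<infinity>) (weights (A + B))"
proof (cases "\<bar>a\<bar> = \<infinity> \<or> \<bar>b\<bar> = \<infinity>")
  case True
  then have "a + b = \<infinity> \<or> a + b = - \<infinity>" by (cases a; cases b) auto
  then show ?thesis by (auto simp: weights_iff[of \<infinity>])
next
  case False
  then obtain y z :: int where "a = ereal (of_int y)" "\<bar>y\<bar> \<le> int A" "b = ereal (of_int z)" "\<bar>z\<bar> \<le> int B"
    using assms by (auto simp: weights_iff)
  then have "a + b = ereal (of_int (y + z))" "\<bar>y + z\<bar> \<le> int (A + B)"
    by auto
  then show ?thesis unfolding insert_iff weights_iff by blast
qed

text \<open>Partial results may be \<open>- \<infinity>\<close> although the final one is not, as in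
  \<open>(- 1) * \<infinity> * (- 1)\<close>. The inductions therefore carry
  \<open>- \<infinity>\<close> along and discard it only at the end.\<close>

lemma weights_gip:
  assumes "\<And>t s. t < k \<Longrightarrow> s < d \<Longrightarrow> x t s \<in> weights W" "gip d k x \<noteq> - \<infinity>"
  shows "gip d k x \<in> weights (d * W ^ k)"
proof -
  have prod: "(\<Prod>t<j. x t s) \<in> insert (- \<infinity>) (weights (W ^ j))" if "j \<le> k" "s < d" for j s
    using that(1)
  proof (induction j)
    case 0
    have "(1::ereal) \<in> weights 1"
      unfolding weights_iff by (intro disjI2 exI[of _ 1]) (simp add: one_ereal_def)
    then show ?case by simp
  next
    case (Suc j)
    then show ?case using weights_mult[of _ "W ^ j" "x j s" W] assms(1)[of j s] that
      by (simp add: mult.commute[of W])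
  qed
  have "(\<Sum>s<j. \<Prod>t<k. x t s) \<in> insert (- \<infinity>) (weights (j * W ^ k))" if "j \<le> d" for j
    using that
  proof (induction j)
    case (Suc j)
    then show ?case using weights_add[OF Suc.IH prod[of k j]] by (simp add: add.commute)
  qed simp
  from this[of d] assms(2) show ?thesis by (simp add: gip_def)
qed

text \<open>The added digits are the most significant ones and are zero, so the value does not
  change.\<close>

lemma stored_at_extend:
  assumes "stored_at c w M a v" "c \<le> c'"
    and "\<And>e. e \<le> c \<Longrightarrow> M' (a' + e) = M (a + e)"
    and "\<And>e. c < e \<Longrightarrow> e \<le> c' \<Longrightarrow> M' (a' + e) = 0"
  shows "stored_at c' w M' a' v"
proof -
  have "M' a' = M a" using assms(3)[of 0] by simp
  moreover have "(\<Sum>i<c'. M' (a' + 1 + i) * 2 ^ (w * i)) = (\<Sum>i<c. M (a + 1 + i) * 2 ^ (w * i))"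
  proof (rule sum.mono_neutral_cong_right)
    show "\<forall>i\<in>{..<c'} - {..<c}. M' (a' + 1 + i) * 2 ^ (w * i) = 0"
      using assms(4)[of "Suc _"] by auto
    show "M' (a' + 1 + i) * 2 ^ (w * i) = M (a + 1 + i) * 2 ^ (w * i)" if "i \<in> {..<c}" for i
      using assms(3)[of "Suc i"] that by simp
  qed (use assms(2) in auto)
  ultimately show ?thesis using assms(1) by (simp add: stored_at_def)
qed

lemma stored_at_zero:
  assumes "\<And>e. e \<le> c \<Longrightarrow> M (a + e) = 0"
  shows "stored_at c w M a 0"
  unfolding stored_at_def using assms[of 0] assms[of "Suc _"]
  by (intro disjI1 exI[of _ 0]) (auto simp: zero_ereal_def)

section \<open>Structured programs on the word RAM\<close>

fun shift :: "nat \<Rightarrow> instr \<Rightarrow> instr" where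
  "shift a (Jmp p) = Jmp (p + a)"
| "shift a (JmpEq r s p) = JmpEq r s (p + a)"
| "shift a (JmpLess r s p) = JmpLess r s (p + a)"
| "shift a I = I"

abbreviation St :: "nat \<Rightarrow> (nat \<Rightarrow> nat) \<Rightarrow> (nat \<Rightarrow> nat) \<Rightarrow> state" where
  "St p g M \<equiv> \<lparr>pc = p, regs = g, mem = M\<rparr>"

definition advance :: "nat \<Rightarrow> state \<Rightarrow> state" where
  "advance a \<sigma> = \<sigma>\<lparr>pc := pc \<sigma> + a\<rparr>"

lemma advance_St [simp]: "advance a (St p g M) = St (p + a) g M"
  by (simp add: advance_def)

section \<open>Runs with a step bound, relocation and composition of code\<close>

definition reach :: "nat \<Rightarrow> instr list \<Rightarrow> nat \<Rightarrow> state \<Rightarrow> state \<Rightarrow> bool" where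
  "reach w P t \<sigma> \<sigma>' \<longleftrightarrow> (\<exists>u\<le>t. (step w P ^^ u) \<sigma> = \<sigma>')"

lemma reach_refl [simp]: "reach w P t \<sigma> \<sigma>"
  unfolding reach_def by (rule exI[of _ 0]) simp

lemma reach_trans:
  assumes "reach w P t \<sigma> \<sigma>'" "reach w P u \<sigma>' \<sigma>''"
  shows "reach w P (t + u) \<sigma> \<sigma>''"
proof -
  obtain a b where "a \<le> t" "(step w P ^^ a) \<sigma> = \<sigma>'" "b \<le> u" "(step w P ^^ b) \<sigma>' = \<sigma>''"
    using assms unfolding reach_def by auto
  then show ?thesis unfolding reach_def
    by (intro exI[of _ "b + a"]) (simp add: funpow_add)
qed

lemma reach_mono: "reach w P t \<sigma> \<sigma>' \<Longrightarrow> t \<le> u \<Longrightarrow> reach w P u \<sigma> \<sigma>'"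
  unfolding reach_def using le_trans by blast

lemma reach_step:
  assumes "p < length P" "reach w P t (exec w (P ! p) (St p g M)) \<sigma>'"
  shows "reach w P (Suc t) (St p g M) \<sigma>'"
proof -
  have "reach w P 1 (St p g M) (exec w (P ! p) (St p g M))"
    unfolding reach_def using assms(1)
    by (intro exI[of _ 1]) (simp add: step_def halted_def)
  from reach_trans[OF this assms(2)] show ?thesis by simp
qed

lemma exec_shift: "exec w (shift a I) (advance a \<sigma>) = advance a (exec w I \<sigma>)"
  by (cases I) (auto simp: advance_def)

text \<open>The bound on the number of steps is an upper bound only, so that nothing has to be said about
  a run that halts early and stutters.\<close>

lemma reach_embed:
  assumes "reach w Q t \<sigma> \<sigma>'"
  shows "reach w (A @ map (shift (length A)) Q @ B) t
           (advance (length A) \<sigma>) (advance (length A) \<sigma>')"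
proof -
  let ?P = "A @ map (shift (length A)) Q @ B"
  have *: "reach w ?P u (advance (length A) \<sigma>) (advance (length A) ((step w Q ^^ u) \<sigma>))" for u
  proof (induction u)
    case (Suc u)
    define \<tau> where "\<tau> = (step w Q ^^ u) \<sigma>"
    have "reach w ?P 1 (advance (length A) \<tau>) (advance (length A) (step w Q \<tau>))"
    proof (cases "halted Q \<tau>")
      case False
      then have lt: "pc \<tau> < length Q" by (simp add: halted_def)
      have "step w ?P (advance (length A) \<tau>) = advance (length A) (step w Q \<tau>)"
        using lt False
        by (simp add: step_def halted_def exec_shift[symmetric] nth_append)
          (simp add: advance_def)
      then show ?thesis unfolding reach_def by (intro exI[of _ 1]) simp
    qed (simp add: step_def)
    from reach_trans[OF Suc.IH[folded \<tau>_def] this] show ?case by (simp add: \<tau>_def)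
  qed simp
  obtain u where "u \<le> t" "(step w Q ^^ u) \<sigma> = \<sigma>'" using assms unfolding reach_def by auto
  then show ?thesis using *[of u] reach_mono by blast
qed

definition seqp :: "instr list \<Rightarrow> instr list \<Rightarrow> instr list" where
  "seqp P Q = P @ map (shift (length P)) Q"

lemma length_seqp [simp]: "length (seqp P Q) = length P + length Q"
  by (simp add: seqp_def)

lemma shift_0 [simp]: "shift 0 I = I"
  by (cases I) auto

lemma map_shift_0 [simp]: "map (shift 0) P = P"
  by (simp add: map_idI)

text \<open>The final state is arbitrary and may lie beyond \<open>P\<close>. The early exit relies
  on this, as it jumps out of its own block.\<close>

lemma reach_seqp1:
  assumes "reach w P t \<sigma> \<sigma>'"
  shows "reach w (seqp P Q) t \<sigma> \<sigma>'"
  using reach_embed[of w P t \<sigma> \<sigma>' "[]" "map (shift (length P)) Q"] assms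
  by (simp add: seqp_def advance_def)

lemma reach_seqp2:
  assumes "reach w Q t (St 0 g M) \<sigma>'"
  shows "reach w (seqp P Q) t (St (length P) g M) (advance (length P) \<sigma>')"
  using reach_embed[of w Q t "St 0 g M" \<sigma>' P "[]"] assms by (simp add: seqp_def)

lemma reach_seqp:
  assumes "reach w P t (St 0 g M) (St (length P) g' M')" "reach w Q u (St 0 g' M') \<sigma>"
  shows "reach w (seqp P Q) (t + u) (St 0 g M) (advance (length P) \<sigma>)"
  using reach_trans[OF reach_seqp1[OF assms(1)] reach_seqp2[OF assms(2)]] .

lemma reach_seqp_St:
  assumes "reach w P t (St 0 g M) (St (length P) g' M')"
    and "reach w Q u (St 0 g' M') (St (length Q) g'' M'')"
  shows "reach w (seqp P Q) (t + u) (St 0 g M) (St (length (seqp P Q)) g'' M'')"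
  using reach_seqp[OF assms] by (simp add: add.commute)

fun target :: "instr \<Rightarrow> nat set" where
  "target (Const r c) = {r}"
| "target (Move r a) = {r}"
| "target (Op f r a b) = {r}"
| "target (Load r a) = {r}"
| "target I = {}"

lemma finite_target [simp]: "finite (target I)"
  by (cases I) auto

lemma regs_step_other:
  assumes "\<And>I. I \<in> set P \<Longrightarrow> r \<notin> target I"
  shows "regs (step w P \<sigma>) r = regs \<sigma> r"
proof (cases "halted P \<sigma>")
  case False
  then have "P ! pc \<sigma> \<in> set P" by (simp add: halted_def)
  then have "r \<notin> target (P ! pc \<sigma>)" by (rule assms)
  then have "regs (exec w (P ! pc \<sigma>) \<sigma>) r = regs \<sigma> r" by (cases "P ! pc \<sigma>") auto
  then show ?thesis using False by (simp add: step_def)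
qed (simp add: step_def)

lemma regs_reach_other:
  assumes "\<And>I. I \<in> set P \<Longrightarrow> r \<notin> target I" "reach w P t \<sigma> \<sigma>'"
  shows "regs \<sigma>' r = regs \<sigma> r"
proof -
  have "regs ((step w P ^^ u) \<sigma>) r = regs \<sigma> r" for u
    by (induction u) (simp_all add: regs_step_other[OF assms(1)])
  then show ?thesis using assms(2) unfolding reach_def by auto
qed

text \<open>A program is finite, so all but finitely many registers keep their initial zero, and a
  fixed number of instructions can restore a clean register file.\<close>

lemma targets_bounded: "\<exists>B. \<forall>I\<in>set P. \<forall>r\<in>target I. r < B"
proof -
  have "finite (\<Union>I\<in>set P. target I)" by auto
  then show ?thesis unfolding finite_nat_set_iff_bounded by auto
qed

section \<open>Expressions, commands and their compilation\<close>

datatype expr = Nat nat | Var nat | Bin binop expr expr | Mem expr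

primrec eval :: "nat \<Rightarrow> (nat \<Rightarrow> nat) \<Rightarrow> (nat \<Rightarrow> nat) \<Rightarrow> expr \<Rightarrow> nat" where
  "eval w g M (Nat c) = c mod 2 ^ w"
| "eval w g M (Var v) = g v"
| "eval w g M (Bin f a b) = apply_op w f (eval w g M a) (eval w g M b)"
| "eval w g M (Mem a) = M (eval w g M a)"

primrec vars :: "expr \<Rightarrow> nat set" where
  "vars (Nat c) = {}"
| "vars (Var v) = {v}"
| "vars (Bin f a b) = vars a \<union> vars b"
| "vars (Mem a) = vars a"

lemma eval_cong: "(\<And>v. v \<in> vars e \<Longrightarrow> f v = g v) \<Longrightarrow> eval w f M e = eval w g M e"
  by (induction e) auto

primrec compile_expr :: "nat \<Rightarrow> expr \<Rightarrow> instr list" where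
  "compile_expr r (Nat c) = [Const r c]"
| "compile_expr r (Var v) = [Move r v]"
| "compile_expr r (Bin f a b) =
     seqp (seqp (compile_expr r a) (compile_expr (Suc r) b)) [Op f r r (Suc r)]"
| "compile_expr r (Mem a) = seqp (compile_expr r a) [Load r r]"

text \<open>The registers from \<open>r\<close> on act as an evaluation stack. Preservation of those
  below keeps the left operand of \<open>Bin\<close> alive while the right one is evaluated at
  \<open>Suc r\<close>.\<close>

lemma compile_expr_correct:
  assumes "vars e \<subseteq> {..<r}"
  shows "\<exists>g'. reach w (compile_expr r e) (length (compile_expr r e)) (St 0 g M)
                (St (length (compile_expr r e)) g' M) \<and>
              g' r = eval w g M e \<and> (\<forall>v<r. g' v = g v)"
  using assms
proof (induction e arbitrary: r g)
  case (Nat c)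
  show ?case
    by (rule exI[of _ "g(r := c mod 2 ^ w)"]) (auto simp: fun_upd_def intro!: reach_step)
next
  case (Var v)
  show ?case
    by (rule exI[of _ "g(r := g v)"]) (auto simp: fun_upd_def intro!: reach_step)
next
  case (Bin f a b)
  obtain g1 where g1: "reach w (compile_expr r a) (length (compile_expr r a)) (St 0 g M)
        (St (length (compile_expr r a)) g1 M)" "g1 r = eval w g M a" "\<forall>v<r. g1 v = g v"
    using Bin.IH(1)[of r g] Bin.prems by auto
  obtain g2 where g2: "reach w (compile_expr (Suc r) b) (length (compile_expr (Suc r) b)) (St 0 g1 M)
        (St (length (compile_expr (Suc r) b)) g2 M)" "g2 (Suc r) = eval w g1 M b"
        "\<forall>v<Suc r. g2 v = g1 v"
    using Bin.IH(2)[of "Suc r" g1] Bin.prems by (auto simp: subset_iff less_Suc_eq)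
  have b: "eval w g1 M b = eval w g M b"
    using Bin.prems g1(3) by (intro eval_cong) auto
  let ?g = "g2(r := apply_op w f (g2 r) (g2 (Suc r)))"
  have "reach w [Op f r r (Suc r)] 1 (St 0 g2 M) (St (length [Op f r r (Suc r)]) ?g M)"
    by (auto intro!: reach_step)
  from reach_seqp_St[OF reach_seqp_St[OF g1(1) g2(1)] this]
  show ?case using g1 g2 b by (intro exI[of _ ?g]) (simp add: fun_upd_def)
next
  case (Mem a)
  obtain g1 where g1: "reach w (compile_expr r a) (length (compile_expr r a)) (St 0 g M)
        (St (length (compile_expr r a)) g1 M)" "g1 r = eval w g M a" "\<forall>v<r. g1 v = g v"
    using Mem.IH[of r g] Mem.prems by auto
  let ?g = "g1(r := M (g1 r))"
  have "reach w [Load r r] 1 (St 0 g1 M) (St (length [Load r r]) ?g M)"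
    by (auto intro!: reach_step)
  from reach_seqp_St[OF g1(1) this]
  show ?case using g1 by (intro exI[of _ ?g]) (simp add: fun_upd_def)
qed

definition compile_expr2 :: "nat \<Rightarrow> expr \<Rightarrow> expr \<Rightarrow> instr list" where
  "compile_expr2 r a b = seqp (compile_expr r a) (compile_expr (Suc r) b)"

lemma compile_expr2_correct:
  assumes "vars a \<subseteq> {..<r}" "vars b \<subseteq> {..<r}"
  shows "\<exists>g'. reach w (compile_expr2 r a b) (length (compile_expr2 r a b)) (St 0 g M)
                (St (length (compile_expr2 r a b)) g' M) \<and>
              g' r = eval w g M a \<and> g' (Suc r) = eval w g M b \<and> (\<forall>v<r. g' v = g v)"
proof -
  obtain g1 where g1: "reach w (compile_expr r a) (length (compile_expr r a)) (St 0 g M)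
        (St (length (compile_expr r a)) g1 M)" "g1 r = eval w g M a" "\<forall>v<r. g1 v = g v"
    using compile_expr_correct[OF assms(1)] by blast
  have "vars b \<subseteq> {..<Suc r}" using assms(2) by auto
  then obtain g2 where g2: "reach w (compile_expr (Suc r) b) (length (compile_expr (Suc r) b)) (St 0 g1 M)
        (St (length (compile_expr (Suc r) b)) g2 M)" "g2 (Suc r) = eval w g1 M b"
        "\<forall>v<Suc r. g2 v = g1 v"
    using compile_expr_correct[of b "Suc r"] by blast
  have "eval w g1 M b = eval w g M b"
    using assms(2) g1(3) by (intro eval_cong) auto
  then show ?thesis
    using reach_seqp_St[OF g1(1) g2(1)] g1 g2 unfolding compile_expr2_def
    by (intro exI[of _ g2]) simp
qed

text \<open>Register \<open>0\<close> holds the size and register \<open>1\<close> the index of the innermost loop; \<open>Loop c\<close> runs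
  \<open>c\<close> for the indices \<open>n - 1, \<dots>, 0\<close>. Loops are not nested. Registers from \<open>R\<close> on are temporary.\<close>

datatype cmd = Skip | Assign nat expr | Put expr expr | IfEq expr expr cmd | Seq cmd cmd | Loop cmd

type_synonym config = "(nat \<Rightarrow> nat) \<times> (nat \<Rightarrow> nat)"

primrec iter :: "(config \<Rightarrow> config) \<Rightarrow> nat \<Rightarrow> config \<Rightarrow> config" where
  "iter D 0 s = s"
| "iter D (Suc j) s = iter D j (D ((fst s)(1 := j), snd s))"

primrec den :: "nat \<Rightarrow> cmd \<Rightarrow> config \<Rightarrow> config" where
  "den w Skip = (\<lambda>s. s)"
| "den w (Assign v e) = (\<lambda>(g, M). (g(v := eval w g M e), M))"
| "den w (Put a e) = (\<lambda>(g, M). (g, M(eval w g M a := eval w g M e)))"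
| "den w (IfEq a b c) = (\<lambda>s. if eval w (fst s) (snd s) a = eval w (fst s) (snd s) b then den w c s else s)"
| "den w (Seq c1 c2) = (\<lambda>s. den w c2 (den w c1 s))"
| "den w (Loop c) = (\<lambda>s. iter (den w c) (fst s 0) ((fst s)(1 := fst s 0), snd s))"

primrec loop_free :: "cmd \<Rightarrow> bool" where
  "loop_free Skip = True"
| "loop_free (Assign v e) = True"
| "loop_free (Put a e) = True"
| "loop_free (IfEq a b c) = loop_free c"
| "loop_free (Seq c1 c2) = (loop_free c1 \<and> loop_free c2)"
| "loop_free (Loop c) = False"

primrec wf_cmd :: "nat \<Rightarrow> cmd \<Rightarrow> bool" where
  "wf_cmd R Skip = True"
| "wf_cmd R (Assign v e) = (2 \<le> v \<and> v < R \<and> vars e \<subseteq> {..<R})"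
| "wf_cmd R (Put a e) = (vars a \<subseteq> {..<R} \<and> vars e \<subseteq> {..<R})"
| "wf_cmd R (IfEq a b c) = (vars a \<subseteq> {..<R} \<and> vars b \<subseteq> {..<R} \<and> wf_cmd R c)"
| "wf_cmd R (Seq c1 c2) = (wf_cmd R c1 \<and> wf_cmd R c2)"
| "wf_cmd R (Loop c) = (loop_free c \<and> wf_cmd R c)"

primrec compile :: "nat \<Rightarrow> cmd \<Rightarrow> instr list" where
  "compile R Skip = []"
| "compile R (Assign v e) = seqp (compile_expr R e) [Move v R]"
| "compile R (Put a e) = seqp (compile_expr2 R a e) [Store R (Suc R)]"
| "compile R (IfEq a b c) = seqp (compile_expr2 R a b)
     (seqp [JmpEq R (Suc R) 2, Jmp (2 + length (compile R c))] (compile R c))"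
| "compile R (Seq c1 c2) = seqp (compile R c1) (compile R c2)"
| "compile R (Loop c) = [Move 1 0, Const R 0, JmpEq 1 R (6 + length (compile R c)), Const R 1, Op Sub 1 1 R]
     @ map (shift 5) (compile R c) @ [Jmp 1]"

text \<open>Loop bodies of well-formed commands are loop free, so their cost does not depend on the
  size and is taken at \<open>0\<close>. Outside the body a loop executes 5 instructions per round,
  and 3 for the initial move and the final test.\<close>

primrec cost :: "nat \<Rightarrow> nat \<Rightarrow> cmd \<Rightarrow> nat" where
  "cost R n Skip = 0"
| "cost R n (Assign v e) = length (compile_expr R e) + 1"
| "cost R n (Put a e) = length (compile_expr2 R a e) + 1"
| "cost R n (IfEq a b c) = length (compile_expr2 R a b) + (2 + cost R n c)"
| "cost R n (Seq c1 c2) = cost R n c1 + cost R n c2"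
| "cost R n (Loop c) = 3 + n * (5 + cost R 0 c)"

lemma cost_loop_free: "loop_free c \<Longrightarrow> cost R n c = cost R 0 c"
  by (induction c) auto

lemma cost_affine: "\<exists>A B. \<forall>n. cost R n c \<le> A * n + B"
proof (induction c)
  case (Assign v e)
  show ?case by (rule exI[of _ 0], rule exI[of _ "length (compile_expr R e) + 1"]) simp
next
  case (Put a e)
  show ?case by (rule exI[of _ 0], rule exI[of _ "length (compile_expr2 R a e) + 1"]) simp
next
  case (Seq c1 c2)
  then obtain A B A' B' where
    "\<forall>n. cost R n c1 \<le> A * n + B" "\<forall>n. cost R n c2 \<le> A' * n + B'" by auto
  then have "\<forall>n. cost R n (Seq c1 c2) \<le> (A + A') * n + (B + B')"
    by (auto simp: algebra_simps intro: add_mono add_le_mono[THEN order_trans])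
  then show ?case by blast
next
  case (IfEq a b c)
  then obtain A B where "\<forall>n. cost R n c \<le> A * n + B" by auto
  then have "\<forall>n. cost R n (IfEq a b c) \<le> A * n + (length (compile_expr2 R a b) + 2 + B)"
    by (auto simp: add.assoc)
  then show ?case by blast
next
  case (Loop c)
  show ?case by (rule exI[of _ "5 + cost R 0 c"], rule exI[of _ 3]) simp
qed auto

lemma den_loop_free_01:
  assumes "wf_cmd R c" "loop_free c" "v < 2"
  shows "fst (den w c s) v = fst s v"
  using assms by (induction c arbitrary: s) (auto split: prod.splits)

lemma den_size:
  assumes "wf_cmd R c"
  shows "fst (den w c s) 0 = fst s 0"
  using assms
proof (induction c arbitrary: s)
  case (Loop c)
  have "fst (iter (den w c) j s) 0 = fst s 0" for j s
    using Loop by (induction j arbitrary: s) auto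
  then show ?case by simp
qed (auto split: prod.splits)

text \<open>The run is described from the loop head at address 1 with \<open>j\<close> rounds left,
  the form that is restored by each round. Correctness of the body is assumed because the induction
  over commands supplies it.\<close>

lemma compile_loop_correct:
  assumes wf: "wf_cmd R c" "loop_free c" "2 \<le> R" "0 < w"
    and body: "\<And>f g M. (\<And>v. v < R \<Longrightarrow> g v = f v) \<Longrightarrow> f 0 < 2 ^ w \<Longrightarrow>
      \<exists>g'. reach w (compile R c) (cost R (f 0) c) (St 0 g M)
             (St (length (compile R c)) g' (snd (den w c (f, M)))) \<and>
           (\<forall>v<R. g' v = fst (den w c (f, M)) v)"
    and "\<And>v. v < R \<Longrightarrow> g v = f v" "f 1 = j" "f 0 < 2 ^ w" "j \<le> f 0"
  shows "\<exists>g'. reach w (compile R (Loop c)) (2 + j * (5 + cost R 0 c)) (St 1 g M)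
             (St (length (compile R (Loop c))) g'
               (snd (iter (den w c) j (f, M)))) \<and>
           (\<forall>v<R. g' v = fst (iter (den w c) j (f, M)) v)"
  using assms(6-)
proof (induction j arbitrary: f g M)
  case 0
  have "g 1 = 0" using 0 wf by auto
  then have "reach w (compile R (Loop c)) (2 + 0) (St 1 g M) (St (length (compile R (Loop c))) (g(R := 0)) M)"
    using wf(3) by (auto simp: eval_nat_numeral intro!: reach_step)
  then show ?case using 0 by (intro exI[of _ "g(R := 0)"]) (simp add: fun_upd_def)
next
  case (Suc j)
  let ?f = "f(1 := j)" and ?g = "g(R := 1, 1 := j)"
  let ?s = "den w c (?f, M)"
  let ?P = "compile R (Loop c)"
  have g1: "g 1 = Suc j" using Suc wf by auto
  have one: "1 mod 2 ^ w = (1::nat)" using wf(4) by (cases w) auto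
  \<comment> \<open>Subtraction on words adds the complement modulo \<open>2 ^ w\<close>. It is
    exact since \<open>Suc j\<close> is at most the size, which fits in a word.\<close>
  have sub: "(Suc j + (2 ^ w - 1)) mod 2 ^ w = j"
  proof -
    have "Suc j + (2 ^ w - 1) = j + 2 ^ w" by simp
    then show ?thesis using Suc.prems by simp
  qed
  have "\<exists>g'. reach w (compile R c) (cost R (?f 0) c) (St 0 ?g M) (St (length (compile R c)) g' (snd ?s)) \<and>
           (\<forall>v<R. g' v = fst ?s v)"
    by (rule body) (use Suc.prems in auto)
  then obtain g1' where g1': "reach w (compile R c) (cost R 0 c) (St 0 ?g M) (St (length (compile R c)) g1' (snd ?s))"
      "\<forall>v<R. g1' v = fst ?s v"
    using cost_loop_free[OF wf(2)] by metis
  have s0: "fst ?s 0 = f 0" and s1: "fst ?s 1 = j"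
    using den_loop_free_01[OF wf(1,2)] by auto
  have "reach w ?P (4 + 0) (St 1 g M) (St 5 ?g M)"
  proof -
    have "reach w ?P (Suc (Suc (Suc (Suc 0)))) (St 1 g M) (St 5 ?g M)"
      using wf(3) one sub g1 by (auto simp: eval_nat_numeral intro!: reach_step)
    then show ?thesis by (simp add: numeral_eq_Suc)
  qed
  moreover have "reach w ?P (cost R 0 c) (St 5 ?g M) (St (5 + length (compile R c)) g1' (snd ?s))"
    using reach_embed[OF g1'(1), of "[Move 1 0, Const R 0, JmpEq 1 R (6 + length (compile R c)), Const R 1, Op Sub 1 1 R]" "[Jmp 1]"]
    by (simp add: add.commute eval_nat_numeral)
  moreover have "reach w ?P (Suc 0) (St (5 + length (compile R c)) g1' (snd ?s)) (St 1 g1' (snd ?s))"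
    by (rule reach_step) (auto simp: nth_append)
  ultimately have r1: "reach w ?P (4 + 0 + cost R 0 c + Suc 0) (St 1 g M) (St 1 g1' (snd ?s))"
    using reach_trans by blast
  obtain g2 where g2: "reach w ?P (2 + j * (5 + cost R 0 c)) (St 1 g1' (snd ?s))
             (St (length ?P) g2
               (snd (iter (den w c) j (fst ?s, snd ?s))))"
           "\<forall>v<R. g2 v = fst (iter (den w c) j (fst ?s, snd ?s)) v"
    using Suc.IH[of g1' "fst ?s" "snd ?s"] Suc.prems g1'(2) s0 s1 by auto
  have "reach w ?P (2 + Suc j * (5 + cost R 0 c)) (St 1 g M)
             (St (length ?P) g2
               (snd (iter (den w c) j (fst ?s, snd ?s))))"
    using reach_trans[OF r1 g2(1)] by (rule reach_mono) simp
  then show ?case using g2(2) by (intro exI[of _ g2]) simp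
qed

text \<open>Abstract registers \<open>f\<close> and machine registers \<open>g\<close> are compared
  below \<open>R\<close> only, since the compiled code uses the others as scratch space that
  \<open>den\<close> does not model.\<close>

theorem compile_correct:
  assumes "wf_cmd R c" "2 \<le> R" "0 < w" "\<And>v. v < R \<Longrightarrow> g v = f v" "f 0 < 2 ^ w"
  shows "\<exists>g'. reach w (compile R c) (cost R (f 0) c) (St 0 g M)
             (St (length (compile R c)) g' (snd (den w c (f, M)))) \<and>
           (\<forall>v<R. g' v = fst (den w c (f, M)) v)"
  using assms
proof (induction c arbitrary: f g M)
  case Skip
  then show ?case by (intro exI[of _ g]) auto
next
  case (Assign v e)
  obtain g1 where g1: "reach w (compile_expr R e) (length (compile_expr R e)) (St 0 g M)
        (St (length (compile_expr R e)) g1 M)" "g1 R = eval w g M e" "\<forall>v<R. g1 v = g v"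
    using compile_expr_correct[of e R w g M] Assign.prems(1) by auto
  have e: "eval w g M e = eval w f M e" using Assign.prems by (intro eval_cong) auto
  have "reach w [Move v R] 1 (St 0 g1 M) (St (length [Move v R]) (g1(v := g1 R)) M)"
    by (auto intro!: reach_step)
  from reach_seqp_St[OF g1(1) this] show ?case
    using g1 e Assign.prems by (intro exI[of _ "g1(v := g1 R)"]) (auto simp: fun_upd_def)
next
  case (Put a e)
  obtain g1 where g1: "reach w (compile_expr2 R a e) (length (compile_expr2 R a e)) (St 0 g M)
        (St (length (compile_expr2 R a e)) g1 M)" "g1 R = eval w g M a" "g1 (Suc R) = eval w g M e"
        "\<forall>v<R. g1 v = g v"
    using compile_expr2_correct[of a R e w g M] Put.prems(1) by auto
  have e: "eval w g M a = eval w f M a" "eval w g M e = eval w f M e"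
    using Put.prems by (auto intro!: eval_cong)
  have "reach w [Store R (Suc R)] 1 (St 0 g1 M)
      (St (length [Store R (Suc R)]) g1 (M(g1 R := g1 (Suc R))))"
    by (auto intro!: reach_step)
  from reach_seqp_St[OF g1(1) this] show ?case
    using g1 e Put.prems by (intro exI[of _ g1]) (auto simp: fun_upd_def)
next
  case (IfEq a b c)
  obtain g1 where g1: "reach w (compile_expr2 R a b) (length (compile_expr2 R a b)) (St 0 g M)
        (St (length (compile_expr2 R a b)) g1 M)" "g1 R = eval w g M a" "g1 (Suc R) = eval w g M b"
        "\<forall>v<R. g1 v = g v"
    using compile_expr2_correct[of a R b w g M] IfEq.prems(1) by auto
  have e: "eval w g M a = eval w f M a" "eval w g M b = eval w f M b"
    using IfEq.prems by (auto intro!: eval_cong)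
  let ?J = "[JmpEq R (Suc R) 2, Jmp (2 + length (compile R c))]"
  show ?case
  proof (cases "eval w f M a = eval w f M b")
    case True
    have "\<exists>g'. reach w (compile R c) (cost R (f 0) c) (St 0 g1 M)
             (St (length (compile R c)) g' (snd (den w c (f, M)))) \<and>
           (\<forall>v<R. g' v = fst (den w c (f, M)) v)"
      by (rule IfEq.IH) (use IfEq.prems g1 in auto)
    then obtain g2 where g2: "reach w (compile R c) (cost R (f 0) c) (St 0 g1 M)
             (St (length (compile R c)) g2 (snd (den w c (f, M))))"
           "\<forall>v<R. g2 v = fst (den w c (f, M)) v" by blast
    have "reach w ?J 2 (St 0 g1 M) (St (length ?J) g1 M)"
      using True g1 e by (auto simp: numeral_2_eq_2 intro!: reach_step)
    from reach_seqp_St[OF g1(1) reach_seqp_St[OF this g2(1)]] show ?thesis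
      using g2 True by (intro exI[of _ g2]) simp
  next
    case False
    have "reach w (seqp ?J (compile R c)) (2 + 0) (St 0 g1 M) (St (length (seqp ?J (compile R c))) g1 M)"
      using False g1 e by (auto simp: numeral_2_eq_2 seqp_def intro!: reach_step)
    from reach_seqp_St[OF g1(1) this] show ?thesis
      using g1 False IfEq.prems by (intro exI[of _ g1]) (auto intro: reach_mono)
  qed
next
  case (Seq c1 c2)
  let ?s = "den w c1 (f, M)"
  obtain g1 where g1: "reach w (compile R c1) (cost R (f 0) c1) (St 0 g M)
             (St (length (compile R c1)) g1 (snd ?s))" "\<forall>v<R. g1 v = fst ?s v"
    using Seq.IH(1)[of g f M] Seq.prems by auto
  have s0: "fst ?s 0 = f 0" using den_size[of R c1] Seq.prems by auto
  have "\<exists>g'. reach w (compile R c2) (cost R (fst ?s 0) c2) (St 0 g1 (snd ?s))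
             (St (length (compile R c2)) g' (snd (den w c2 (fst ?s, snd ?s)))) \<and>
           (\<forall>v<R. g' v = fst (den w c2 (fst ?s, snd ?s)) v)"
    by (rule Seq.IH(2)) (use Seq.prems g1 s0 in auto)
  then obtain g2 where g2: "reach w (compile R c2) (cost R (f 0) c2) (St 0 g1 (snd ?s))
             (St (length (compile R c2)) g2 (snd (den w c2 ?s)))"
           "\<forall>v<R. g2 v = fst (den w c2 ?s) v" using s0 by auto
  show ?case using reach_seqp_St[OF g1(1) g2(1)] g2(2) by (intro exI[of _ g2]) simp
next
  case (Loop c)
  have wf: "wf_cmd R c" "loop_free c" using Loop.prems by auto
  let ?P = "compile R (Loop c)"
  have "\<exists>g'. reach w ?P (2 + f 0 * (5 + cost R 0 c)) (St 1 (g(1 := g 0)) M)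
             (St (length ?P) g' (snd (den w (Loop c) (f, M)))) \<and>
           (\<forall>v<R. g' v = fst (den w (Loop c) (f, M)) v)"
    using compile_loop_correct[OF wf Loop.prems(2,3) Loop.IH, of "g(1 := g 0)" "f(1 := f 0)" "f 0" M]
      Loop.prems wf by auto
  then obtain g' where g': "reach w ?P (2 + f 0 * (5 + cost R 0 c)) (St 1 (g(1 := g 0)) M)
             (St (length ?P) g' (snd (den w (Loop c) (f, M))))"
           "\<forall>v<R. g' v = fst (den w (Loop c) (f, M)) v" by blast
  have "reach w ?P (Suc (2 + f 0 * (5 + cost R 0 c))) (St 0 g M)
             (St (length ?P) g' (snd (den w (Loop c) (f, M))))"
    using g'(1) by (intro reach_step) auto
  then show ?case using g'(2) by (intro exI[of _ g']) (simp add: eval_nat_numeral)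
qed

section \<open>Detecting negative infinite inner products\<close>

definition cell :: "nat \<Rightarrow> nat \<Rightarrow> nat \<Rightarrow> expr" where
  "cell b u e = Bin Add (Bin Mul (Bin Add (Bin Mul (Nat b) (Var 0)) (Var 1)) (Nat u)) (Nat e)"

lemma vars_cell [simp]: "vars (cell b u e) = {0, 1}"
  by (auto simp: cell_def)

lemma eval_cell: "eval w g M (cell b u e) = ((b * g 0 + g 1) * u + e) mod 2 ^ w"
  by (simp add: cell_def mod_simps)

text \<open>The digits are joined by bitwise disjunction because a sum of words could wrap around to
  zero.\<close>

definition digits_expr :: "nat \<Rightarrow> nat \<Rightarrow> nat \<Rightarrow> nat \<Rightarrow> nat \<Rightarrow> expr" where
  "digits_expr d c t s j =
     foldr (\<lambda>e x. Bin Or (Mem (cell t (d * (c + 1)) (s * (c + 1) + 1 + e))) x) [0..<j] (Nat 0)"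

lemma vars_foldr_Or: "(\<And>e. e \<in> set es \<Longrightarrow> vars (F e) \<subseteq> V) \<Longrightarrow>
    vars (foldr (\<lambda>e x. Bin Or (F e) x) es (Nat 0)) \<subseteq> V"
  by (induction es) auto

lemma eval_foldr_Or_eq_0:
  "eval w g M (foldr (\<lambda>e x. Bin Or (F e) x) es (Nat 0)) = 0 \<longleftrightarrow> (\<forall>e\<in>set es. eval w g M (F e) = 0)"
  by (induction es) (auto simp: or_eq_0_iff)

text \<open>Division by zero yields \<open>0\<close>, so \<open>x div x\<close> is the indicator of \<open>x \<noteq> 0\<close>.\<close>

definition signature_expr :: "nat \<Rightarrow> nat \<Rightarrow> nat \<Rightarrow> nat \<Rightarrow> expr" where
  "signature_expr d c t s =
     (let x = digits_expr d c t s c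
      in Bin Add (Bin Mul (Nat 2) (Mem (cell t (d * (c + 1)) (s * (c + 1))))) (Bin Div x x))"

primrec type_expr :: "nat \<Rightarrow> nat \<Rightarrow> nat \<Rightarrow> nat \<Rightarrow> expr" where
  "type_expr d c t 0 = Nat 0"
| "type_expr d c t (Suc s) =
     Bin Add (type_expr d c t s) (Bin Mul (signature_expr d c t s) (Nat (6 ^ s)))"

lemma vars_signature_expr: "vars (signature_expr d c t s) \<subseteq> {0, 1}"
  using vars_foldr_Or[of "[0..<c]" "\<lambda>e. Mem (cell t (d * (c + 1)) (s * (c + 1) + 1 + e))" "{0, 1}"]
  by (simp add: signature_expr_def digits_expr_def Let_def)

lemma vars_type_expr: "vars (type_expr d c t j) \<subseteq> {0, 1}"
  using vars_signature_expr by (induction j) auto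

lemma eval_signature_expr:
  assumes "\<And>e. e \<le> c \<Longrightarrow> (t * g 0 + g 1) * (d * (c + 1)) + s * (c + 1) + e < 2 ^ w"
  shows "eval w g M (signature_expr d c t s) =
    signature c M ((t * g 0 + g 1) * (d * (c + 1)) + s * (c + 1)) mod 2 ^ w"
proof -
  let ?a = "(t * g 0 + g 1) * (d * (c + 1)) + s * (c + 1)"
  let ?O = "eval w g M (digits_expr d c t s c)"
  have tag: "eval w g M (cell t (d * (c + 1)) (s * (c + 1))) = ?a"
    using assms[of 0] by (simp add: eval_cell)
  have digit: "eval w g M (cell t (d * (c + 1)) (s * (c + 1) + 1 + e)) = ?a + 1 + e" if "e < c" for e
    using assms[of "Suc e"] that by (simp add: eval_cell)
  have "?O = 0 \<longleftrightarrow> (\<forall>e<c. M (?a + 1 + e) = 0)"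
    unfolding digits_expr_def eval_foldr_Or_eq_0 using digit by auto
  then have "?O div ?O = (if \<exists>e<c. M (?a + 1 + e) \<noteq> 0 then 1 else 0)" by auto
  then show ?thesis
    unfolding signature_expr_def Let_def signature_def using tag by (simp add: mod_simps)
qed

lemma eval_type_expr:
  assumes "\<And>s e. s < d \<Longrightarrow> e \<le> c \<Longrightarrow> (t * g 0 + g 1) * (d * (c + 1)) + s * (c + 1) + e < 2 ^ w"
  shows "eval w g M (type_expr d c t d) = vector_type d c (g 0) M t (g 1) mod 2 ^ w"
proof -
  have "eval w g M (type_expr d c t j) =
     encode j (\<lambda>s. signature c M ((t * g 0 + g 1) * (d * (c + 1)) + s * (c + 1))) mod 2 ^ w"
    if "j \<le> d" for j
    using that
  proof (induction j)
    case (Suc j)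
    then show ?case using eval_signature_expr[of c t g d j w M] assms[of j] by (simp add: mod_simps)
  qed simp
  from this[of d] show ?thesis by (simp add: vector_type_def)
qed

section \<open>Flags for the types that occur, and the verdict drawn from them\<close>

definition seqs :: "cmd list \<Rightarrow> cmd" where
  "seqs cs = foldr Seq cs Skip"

lemma seqs_simps [simp]: "seqs [] = Skip" "seqs (c # cs) = Seq c (seqs cs)"
  by (simp_all add: seqs_def)

lemma wf_seqs [simp]: "wf_cmd R (seqs cs) \<longleftrightarrow> (\<forall>c\<in>set cs. wf_cmd R c)"
  by (induction cs) auto

lemma loop_free_seqs [simp]: "loop_free (seqs cs) \<longleftrightarrow> (\<forall>c\<in>set cs. loop_free c)"
  by (induction cs) auto

text \<open>Register numbers are fixed in the instructions and cannot be computed. A flag selected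
  by a value is therefore set by comparing the value with every candidate \<open>C x\<close> in
  turn.\<close>

definition marks :: "('a \<Rightarrow> expr) \<Rightarrow> ('a \<Rightarrow> nat) \<Rightarrow> ('a \<Rightarrow> nat) \<Rightarrow> 'a list \<Rightarrow> cmd" where
  "marks E C F xs = seqs (map (\<lambda>x. IfEq (E x) (Nat (C x)) (Assign (F x) (Nat 1))) xs)"

text \<open>Only registers from 2 on are written, whereas the tested values are determined by
  registers 0 and 1 and the memory. Hence earlier marks do not influence later tests.\<close>

lemma den_marks:
  assumes "0 < w" "f 0 = n" "f 1 = i"
    and "\<And>g x. g 0 = n \<Longrightarrow> g 1 = i \<Longrightarrow> x \<in> set xs \<Longrightarrow> eval w g M (E x) = V x"
    and "\<And>x. x \<in> set xs \<Longrightarrow> 2 \<le> F x"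
  shows "den w (marks E C F xs) (f, M) =
    (\<lambda>r. if \<exists>x\<in>set xs. F x = r \<and> V x = C x mod 2 ^ w then 1 else f r, M)"
  using assms(2-)
proof (induction xs arbitrary: f)
  case (Cons x xs)
  have one: "1 mod 2 ^ w = (1::nat)" using assms(1) by (cases w) auto
  let ?f = "if V x = C x mod 2 ^ w then f(F x := 1) else f"
  have "F x \<noteq> 0" "F x \<noteq> 1" using Cons.prems(4)[of x] by auto
  then have "den w (marks E C F xs) (?f, M) =
      (\<lambda>r. if \<exists>x\<in>set xs. F x = r \<and> V x = C x mod 2 ^ w then 1 else ?f r, M)"
    using Cons.prems by (intro Cons.IH) auto
  moreover have "eval w f M (E x) = V x" using Cons.prems by simp
  ultimately show ?case using one by (auto simp: marks_def, auto simp: fun_eq_iff)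
qed (simp add: marks_def)

text \<open>Flags are never cleared, so the rounds accumulate an existential quantifier over the
  indices.\<close>

lemma den_Loop_marks:
  assumes "0 < w" "f 0 = n"
    and V: "\<And>g i x. g 0 = n \<Longrightarrow> g 1 = i \<Longrightarrow> i < n \<Longrightarrow> x \<in> set xs \<Longrightarrow> eval w g M (E x) = V i x"
    and F: "\<And>x. x \<in> set xs \<Longrightarrow> 2 \<le> F x"
  shows "\<exists>f'. den w (Loop (marks E C F xs)) (f, M) = (f', M) \<and> f' 0 = n \<and>
    (\<forall>r\<ge>2. f' r = (if \<exists>i<n. \<exists>x\<in>set xs. F x = r \<and> V i x = C x mod 2 ^ w then 1 else f r))"
proof -
  have "\<exists>f'. iter (den w (marks E C F xs)) j (f, M) = (f', M) \<and> f' 0 = n \<and>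
    (\<forall>r\<ge>2. f' r = (if \<exists>i<j. \<exists>x\<in>set xs. F x = r \<and> V i x = C x mod 2 ^ w then 1 else f r))"
    if "f 0 = n" "j \<le> n" for j f
    using that
  proof (induction j arbitrary: f)
    case (Suc j)
    define f1 where "f1 = (\<lambda>r. if \<exists>x\<in>set xs. F x = r \<and> V j x = C x mod 2 ^ w then 1 else (f(1 := j)) r)"
    have den: "den w (marks E C F xs) (f(1 := j), M) = (f1, M)"
      unfolding f1_def using Suc.prems by (intro den_marks[OF assms(1) _ _ V F]) auto
    have f10: "f1 0 = n" using F Suc.prems unfolding f1_def by fastforce
    have "j \<le> n" using Suc.prems by simp
    from Suc.IH[where f = f1, OF f10 this] obtain f' where f': "iter (den w (marks E C F xs)) j (f1, M) = (f', M)"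
      "f' 0 = n"
      "\<forall>r\<ge>2. f' r = (if \<exists>i<j. \<exists>x\<in>set xs. F x = r \<and> V i x = C x mod 2 ^ w then 1 else f1 r)"
      by auto
    have "iter (den w (marks E C F xs)) (Suc j) (f, M) = (f', M)"
      using f'(1) by (simp only: iter.simps fst_conv snd_conv den)
    moreover have "f' r = (if \<exists>i<Suc j. \<exists>x\<in>set xs. F x = r \<and> V i x = C x mod 2 ^ w then 1 else f r)"
      if "2 \<le> r" for r
    proof -
      define Q where "Q i \<longleftrightarrow> (\<exists>x\<in>set xs. F x = r \<and> V i x = C x mod 2 ^ w)" for i
      have "f' r = (if \<exists>i<j. Q i then 1 else f1 r)"
        using f'(3)[rule_format, OF that] unfolding Q_def .
      moreover have "f1 r = (if Q j then 1 else f r)" unfolding f1_def Q_def using that by auto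
      moreover have "(\<exists>i<Suc j. Q i) \<longleftrightarrow> (\<exists>i<j. Q i) \<or> Q j" by (auto simp: less_Suc_eq)
      ultimately show ?thesis unfolding Q_def[symmetric] by presburger
    qed
    ultimately show ?case using f'(2) by blast
  qed simp
  from this[of "f(1 := n)" n] assms(2) obtain f' where
    "iter (den w (marks E C F xs)) n (f(1 := n), M) = (f', M)" "f' 0 = n"
    "\<forall>r\<ge>2. f' r = (if \<exists>i<n. \<exists>x\<in>set xs. F x = r \<and> V i x = C x mod 2 ^ w then 1 else (f(1 := n)) r)"
    by auto
  moreover from this(3) have "\<forall>r\<ge>2. f' r =
      (if \<exists>i<n. \<exists>x\<in>set xs. F x = r \<and> V i x = C x mod 2 ^ w then 1 else f r)"
    by auto
  ultimately show ?thesis using assms(2) by (intro exI[of _ f']) (simp only: den.simps fst_conv snd_conv simp_thms)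
qed

primrec all_set :: "nat list \<Rightarrow> cmd \<Rightarrow> cmd" where
  "all_set [] c = c"
| "all_set (v # vs) c = IfEq (Var v) (Nat 1) (all_set vs c)"

lemma den_all_set:
  "0 < w \<Longrightarrow> den w (all_set vs c) s = (if \<forall>v\<in>set vs. fst s v = 1 then den w c s else s)"
  by (induction vs) (auto simp: mod_less)

lemma wf_all_set [simp]: "wf_cmd R (all_set vs c) \<longleftrightarrow> (\<forall>v\<in>set vs. v < R) \<and> wf_cmd R c"
  by (induction vs) auto

text \<open>Registers 0, 1 and 2 hold the size, the loop index and the verdict; the flags for pairs
  of a set and a type follow in row-major order.\<close>

definition flag :: "nat \<Rightarrow> nat \<Rightarrow> nat \<Rightarrow> nat" where
  "flag d t \<tau> = 3 + (t * 6 ^ d + \<tau>)"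

lemma flag_inject: "\<tau> < 6 ^ d \<Longrightarrow> \<tau>' < 6 ^ d \<Longrightarrow> flag d t \<tau> = flag d t' \<tau>' \<longleftrightarrow> t = t' \<and> \<tau> = \<tau>'"
proof safe
  assume "\<tau> < 6 ^ d" "\<tau>' < 6 ^ d" "flag d t \<tau> = flag d t' \<tau>'"
  then have "(t * 6 ^ d + \<tau>) div 6 ^ d = (t' * 6 ^ d + \<tau>') div 6 ^ d"
    "(t * 6 ^ d + \<tau>) mod 6 ^ d = (t' * 6 ^ d + \<tau>') mod 6 ^ d" by (auto simp: flag_def)
  with \<open>\<tau> < 6 ^ d\<close> \<open>\<tau>' < 6 ^ d\<close> show "t = t'" "\<tau> = \<tau>'" by auto
qed

lemma flag_less: "t < k \<Longrightarrow> \<tau> < 6 ^ d \<Longrightarrow> flag d t \<tau> < 3 + k * 6 ^ d"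
proof -
  assume "t < k" "\<tau> < 6 ^ d"
  moreover from this have "Suc t * 6 ^ d \<le> k * 6 ^ d" by (intro mult_right_mono) auto
  ultimately show ?thesis by (simp add: flag_def)
qed

definition detect :: "nat \<Rightarrow> nat \<Rightarrow> nat \<Rightarrow> cmd" where
  "detect k d c = Loop (marks (\<lambda>(t, \<tau>). type_expr d c t d) snd (\<lambda>(t, \<tau>). flag d t \<tau>)
     (List.product [0..<k] [0..<6 ^ d]))"

text \<open>The list \<open>bs\<close> is part of the program text, so this takes constant
  time.\<close>

definition judge :: "nat \<Rightarrow> nat \<Rightarrow> nat list list \<Rightarrow> cmd" where
  "judge k d bs =
     seqs (map (\<lambda>\<tau>s. all_set (map (\<lambda>t. flag d t (\<tau>s ! t)) [0..<k]) (Assign 2 (Nat 1))) bs)"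

lemma den_judge:
  assumes "0 < w"
  shows "den w (judge k d bs) (f, M) =
    (f(2 := if \<exists>\<tau>s\<in>set bs. \<forall>t<k. f (flag d t (\<tau>s ! t)) = 1 then 1 else f 2), M)"
proof (induction bs arbitrary: f)
  case (Cons \<tau>s bs)
  have one: "1 mod 2 ^ w = (1::nat)" using assms by (cases w) auto
  have ne: "flag d t \<tau> \<noteq> 2" for t \<tau> by (simp add: flag_def)
  let ?f = "if \<forall>t<k. f (flag d t (\<tau>s ! t)) = 1 then f(2 := 1) else f"
  have "den w (judge k d (\<tau>s # bs)) (f, M) = den w (judge k d bs) (?f, M)"
    using one by (auto simp: judge_def den_all_set[OF assms])
  also have "\<dots> = (f(2 := if \<exists>\<tau>s\<in>set (\<tau>s # bs). \<forall>t<k. f (flag d t (\<tau>s ! t)) = 1 then 1 else f 2), M)"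
    unfolding Cons.IH using ne by (auto simp: fun_eq_iff)
  finally show ?case .
qed (simp add: judge_def)

lemma wf_detect: "3 + k * 6 ^ d \<le> R \<Longrightarrow> wf_cmd R (detect k d c)"
proof -
  assume R: "3 + k * 6 ^ d \<le> R"
  have "vars (type_expr d c t d) \<subseteq> {..<R}" for t
    using vars_type_expr[of d c t d] R by auto
  moreover have "flag d t \<tau> < R" "2 \<le> flag d t \<tau>" if "t < k" "\<tau> < 6 ^ d" for t \<tau>
    using flag_less[OF that] R by (auto simp: flag_def)
  ultimately show ?thesis by (auto simp: detect_def marks_def)
qed

lemma wf_judge:
  "3 + k * 6 ^ d \<le> R \<Longrightarrow> set bs \<subseteq> tuples k (6 ^ d) \<Longrightarrow> wf_cmd R (judge k d bs)"
proof -
  assume R: "3 + k * 6 ^ d \<le> R" and bs: "set bs \<subseteq> tuples k (6 ^ d)"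
  have "flag d t (\<tau>s ! t) < R" if "\<tau>s \<in> set bs" "t < k" for \<tau>s t
    using flag_less[OF that(2)] tuples_nth[of \<tau>s k "6 ^ d" t] that bs R by fastforce
  then show ?thesis using R by (auto simp: judge_def)
qed

lemma cell_bound:
  fixes b i q :: nat
  assumes "b < B" "i < n" "q < u"
  shows "(b * n + i) * u + q < B * n * u"
proof -
  have "Suc b * n \<le> B * n" using assms by (intro mult_right_mono) auto
  then have "Suc (b * n + i) \<le> B * n" using assms by simp
  then have "Suc (b * n + i) * u \<le> B * n * u" by (rule mult_right_mono) simp
  then show ?thesis using assms by simp
qed

text \<open>The bound on \<open>6 ^ d\<close> allows types to be compared as words, and the bound on
  the input length keeps address computations from wrapping around.\<close>

lemma den_detect_judge:
  assumes "0 < w" "(6::nat) ^ d \<le> 2 ^ w" "k * n * d * (c + 1) \<le> 2 ^ w" "f 0 = n" "\<And>r. 2 \<le> r \<Longrightarrow> f r = 0"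
    and type: "\<And>t i. t < k \<Longrightarrow> i < n \<Longrightarrow> vector_type d c n M t i < 6 ^ d"
    and bs: "set bs = bad_types k d"
  shows "\<exists>f'. den w (Seq (detect k d c) (judge k d bs)) (f, M) = (f', M) \<and> f' 0 = n \<and>
     f' 2 = (if \<exists>\<tau>s\<in>bad_types k d. \<forall>t<k. \<exists>i<n. vector_type d c n M t i = \<tau>s ! t then 1 else 0)"
proof -
  let ?xs = "List.product [0..<k] [0..<6 ^ d]"
  have addr: "(t * n + i) * (d * (c + 1)) + s * (c + 1) + e < 2 ^ w"
    if "t < k" "i < n" "s < d" "e \<le> c" for t i s e
  proof -
    have "s * (c + 1) + e < d * (c + 1)"
      using cell_bound[of s d 0 1 e "c + 1"] that by simp
    then have "(t * n + i) * (d * (c + 1)) + (s * (c + 1) + e) < k * n * (d * (c + 1))"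
      using that by (intro cell_bound)
    then show ?thesis using assms(3) by (simp only: add.assoc mult.assoc)
  qed
  have "\<exists>f'. den w (detect k d c) (f, M) = (f', M) \<and> f' 0 = n \<and>
    (\<forall>r\<ge>2. f' r = (if \<exists>i<n. \<exists>x\<in>set ?xs. (case x of (t, \<tau>) \<Rightarrow> flag d t \<tau>) = r \<and>
        (case x of (t, \<tau>) \<Rightarrow> vector_type d c n M t i) = snd x mod 2 ^ w then 1 else f r))"
    unfolding detect_def
  proof (rule den_Loop_marks[where f = f and n = n, OF assms(1,4)])
    fix g :: "nat \<Rightarrow> nat" and i x assume g: "g 0 = n" "g 1 = i" "i < n" and x: "x \<in> set ?xs"
    obtain t \<tau> where t: "x = (t, \<tau>)" "t < k" using x by auto
    have "eval w g M (type_expr d c t d) = vector_type d c n M t i mod 2 ^ w"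
      using eval_type_expr[of d c t g w M] addr t g by auto
    also have "\<dots> = vector_type d c n M t i" using type[OF t(2) g(3)] assms(2) by simp
    finally show "eval w g M (case x of (t, \<tau>) \<Rightarrow> type_expr d c t d) =
        (case x of (t, \<tau>) \<Rightarrow> vector_type d c n M t i)" using t by simp
  qed (auto simp: flag_def)
  then obtain f1 where f1: "den w (detect k d c) (f, M) = (f1, M)" "f1 0 = n"
    "\<And>r. r \<ge> 2 \<Longrightarrow> f1 r = (if \<exists>i<n. \<exists>x\<in>set ?xs. (case x of (t, \<tau>) \<Rightarrow> flag d t \<tau>) = r \<and>
        (case x of (t, \<tau>) \<Rightarrow> vector_type d c n M t i) = snd x mod 2 ^ w then 1 else f r)" by auto
  have flag: "f1 (flag d t \<tau>) = 1 \<longleftrightarrow> (\<exists>i<n. vector_type d c n M t i = \<tau>)" if "t < k" "\<tau> < 6 ^ d" for t \<tau>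
  proof -
    have "(\<exists>x\<in>set ?xs. (case x of (t, \<tau>) \<Rightarrow> flag d t \<tau>) = flag d t \<tau> \<and>
        (case x of (t, \<tau>) \<Rightarrow> vector_type d c n M t i) = snd x mod 2 ^ w) \<longleftrightarrow>
      vector_type d c n M t i = \<tau>" for i
    proof
      assume "vector_type d c n M t i = \<tau>"
      then show "\<exists>x\<in>set ?xs. (case x of (t, \<tau>) \<Rightarrow> flag d t \<tau>) = flag d t \<tau> \<and>
        (case x of (t, \<tau>) \<Rightarrow> vector_type d c n M t i) = snd x mod 2 ^ w"
        using that assms(2) by (intro bexI[of _ "(t, \<tau>)"]) auto
    next
      assume "\<exists>x\<in>set ?xs. (case x of (t, \<tau>) \<Rightarrow> flag d t \<tau>) = flag d t \<tau> \<and>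
        (case x of (t, \<tau>) \<Rightarrow> vector_type d c n M t i) = snd x mod 2 ^ w"
      then obtain t' \<tau>' where x: "\<tau>' < 6 ^ d" "flag d t' \<tau>' = flag d t \<tau>"
          "vector_type d c n M t' i = \<tau>' mod 2 ^ w" by auto
      then show "vector_type d c n M t i = \<tau>"
        using flag_inject[OF x(1) that(2)] assms(2) by simp
    qed
    moreover have "f (flag d t \<tau>) = 0" "2 \<le> flag d t \<tau>" using assms(5) by (auto simp: flag_def)
    ultimately have "f1 (flag d t \<tau>) = (if \<exists>i<n. vector_type d c n M t i = \<tau> then 1 else 0)"
      using f1(3)[of "flag d t \<tau>"] by (simp only:)
    then show ?thesis by simp
  qed
  have f12: "f1 2 = 0" using f1(3)[of 2] assms(5) by (auto simp: flag_def)
  have "(\<exists>\<tau>s\<in>bad_types k d. \<forall>t<k. f1 (flag d t (\<tau>s ! t)) = 1) \<longleftrightarrow>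
     (\<exists>\<tau>s\<in>bad_types k d. \<forall>t<k. \<exists>i<n. vector_type d c n M t i = \<tau>s ! t)"
    using flag tuples_nth[of _ k "6 ^ d"] by (intro bex_cong) (auto simp: bad_types_def)
  then show ?thesis
    using f1(1,2) f12 by (simp add: den_judge[OF assms(1)] bs)
qed

section \<open>Rewriting the input in place\<close>

text \<open>A block of the new input consists of \<open>n\<close> vectors; block \<open>2 * t + h\<close> holds the vectors of the
  factor \<open>t\<close> of the first tensor with indices \<open>h * n, \<dots>, h * n + n - 1\<close>. The block is either zero or
  a copy of the vectors of the \<open>t\<close>-th set, with every number extended from \<open>c\<close> to \<open>c'\<close> words.\<close>

definition is_zero_cell :: "nat \<Rightarrow> nat \<Rightarrow> nat \<Rightarrow> nat \<Rightarrow> nat \<Rightarrow> bool" where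
  "is_zero_cell k c c' b q \<longleftrightarrow> b = 0 \<or> b = 2 * k - 1 \<or> c < q mod (c' + 1)"

definition source_offset :: "nat \<Rightarrow> nat \<Rightarrow> nat \<Rightarrow> nat" where
  "source_offset c c' q = q div (c' + 1) * (c + 1) + q mod (c' + 1)"

definition block_expr :: "nat \<Rightarrow> nat \<Rightarrow> nat \<Rightarrow> nat \<Rightarrow> nat \<Rightarrow> nat \<Rightarrow> expr" where
  "block_expr k d c c' b q = (if is_zero_cell k c c' b q then Nat 0
     else Mem (cell (b div 2) (d * (c + 1)) (source_offset c c' q)))"

definition rewrite_block :: "nat \<Rightarrow> nat \<Rightarrow> nat \<Rightarrow> nat \<Rightarrow> nat \<Rightarrow> cmd" where
  "rewrite_block k d c c' b = Loop (seqs (map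
     (\<lambda>q. Put (cell b (d * (c' + 1)) q) (block_expr k d c c' b q)) (rev [0..<d * (c' + 1)])))"

definition rewrite :: "nat \<Rightarrow> nat \<Rightarrow> nat \<Rightarrow> nat \<Rightarrow> cmd" where
  "rewrite k d c c' = seqs (map (rewrite_block k d c c') (rev [0..<2 * k]))"

lemma wf_rewrite: "2 \<le> R \<Longrightarrow> wf_cmd R (rewrite k d c c')"
  by (auto simp: rewrite_def rewrite_block_def block_expr_def)

text \<open>Only the \<open>2 * k\<close> blocks of the first tensor are rewritten. The factors of
  the other tensors are zero, and their cells lie beyond the old input, where an input memory is
  zero already.\<close>

definition new_mem :: "nat \<Rightarrow> nat \<Rightarrow> nat \<Rightarrow> nat \<Rightarrow> nat \<Rightarrow> (nat \<Rightarrow> nat) \<Rightarrow> nat \<Rightarrow> nat" where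
  "new_mem k d c c' n M a =
     (let u = d * (c' + 1); b = a div u div n; i = a div u mod n; q = a mod u
      in if 2 * k * n * u \<le> a then M a
         else if is_zero_cell k c c' b q then 0
         else M ((b div 2 * n + i) * (d * (c + 1)) + source_offset c c' q))"

lemma new_mem_cell:
  assumes "b < 2 * k" "i < n" "q < d * (c' + 1)"
  shows "new_mem k d c c' n M ((b * n + i) * (d * (c' + 1)) + q) =
    (if is_zero_cell k c c' b q then 0
     else M ((b div 2 * n + i) * (d * (c + 1)) + source_offset c c' q))"
proof -
  let ?u = "d * (c' + 1)"
  let ?a = "(b * n + i) * ?u + q"
  have "?a div ?u = b * n + i" "?a mod ?u = q" using assms(3)
    by (simp_all only: div_mult_self3[OF gr_implies_not0[OF assms(3)]] mod_mult_self3 div_less mod_less add_0_right)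
  moreover have "(b * n + i) div n = b" "(b * n + i) mod n = i" using assms(2) by simp_all
  moreover have "\<not> 2 * k * n * ?u \<le> ?a" using cell_bound[OF assms] by simp
  ultimately show ?thesis by (simp only: new_mem_def Let_def if_False)
qed

text \<open>A descending pass that has come down to address \<open>\<theta>\<close>: new contents
  from there on, old contents below.\<close>

definition partial_mem :: "nat \<Rightarrow> nat \<Rightarrow> nat \<Rightarrow> nat \<Rightarrow> nat \<Rightarrow> (nat \<Rightarrow> nat) \<Rightarrow> nat \<Rightarrow> nat \<Rightarrow> nat" where
  "partial_mem k d c c' n M \<theta> a = (if \<theta> \<le> a then new_mem k d c c' n M a else M a)"

text \<open>Both changes move data upwards: every set is spread over two blocks, and every number is
  widened.\<close>

lemma source_le:
  assumes "c \<le> c'"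
  shows "(b div 2 * n + i) * (d * (c + 1)) + source_offset c c' q \<le> (b * n + i) * (d * (c' + 1)) + q"
proof -
  have "source_offset c c' q \<le> q div (c' + 1) * (c' + 1) + q mod (c' + 1)"
    unfolding source_offset_def using assms by (intro add_right_mono mult_left_mono) auto
  also have "\<dots> = q" by (rule div_mult_mod_eq)
  finally show ?thesis using assms by (intro add_mono mult_mono) auto
qed

text \<open>Since every cell is copied from an address that is not larger, overwriting the cells in
  descending order never destroys a cell that is still needed.\<close>

lemma den_Put_block:
  assumes "c \<le> c'" "2 * k * n * (d * (c' + 1)) \<le> 2 ^ w"
    and "b < 2 * k" "i < n" "q < d * (c' + 1)" "f 0 = n" "f 1 = i"
  shows "den w (Put (cell b (d * (c' + 1)) q) (block_expr k d c c' b q))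
      (f, partial_mem k d c c' n M ((b * n + i) * (d * (c' + 1)) + Suc q)) =
    (f, partial_mem k d c c' n M ((b * n + i) * (d * (c' + 1)) + q))"
proof -
  let ?\<theta> = "(b * n + i) * (d * (c' + 1)) + q"
  let ?G = "partial_mem k d c c' n M"
  let ?src = "(b div 2 * n + i) * (d * (c + 1)) + source_offset c c' q"
  have lt: "?\<theta> < 2 ^ w" using cell_bound[OF assms(3-5)] assms(2) by simp
  have le: "?src \<le> ?\<theta>" by (rule source_le[OF assms(1)])
  have "eval w f (?G (Suc ?\<theta>)) (cell b (d * (c' + 1)) q) = ?\<theta>"
    unfolding eval_cell assms(6,7) using lt by (rule mod_less)
  moreover have "eval w f (?G (Suc ?\<theta>)) (cell (b div 2) (d * (c + 1)) (source_offset c c' q)) = ?src"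
    unfolding eval_cell assms(6,7) using le_less_trans[OF le lt] by (rule mod_less)
  then have "eval w f (?G (Suc ?\<theta>)) (block_expr k d c c' b q) =
      (if is_zero_cell k c c' b q then 0 else M ?src)"
    unfolding block_expr_def using le by (simp add: partial_mem_def)
  then have "eval w f (?G (Suc ?\<theta>)) (block_expr k d c c' b q) = new_mem k d c c' n M ?\<theta>"
    unfolding new_mem_cell[OF assms(3-5)] .
  moreover have "(?G (Suc ?\<theta>))(?\<theta> := new_mem k d c c' n M ?\<theta>) = ?G ?\<theta>"
    by (auto simp: partial_mem_def fun_eq_iff)
  ultimately show ?thesis by (simp only: den.simps prod.case add_Suc_right)
qed

lemma den_Put_blocks:
  assumes "c \<le> c'" "2 * k * n * (d * (c' + 1)) \<le> 2 ^ w"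
    and "b < 2 * k" "i < n" "j \<le> d * (c' + 1)" "f 0 = n" "f 1 = i"
  shows "den w (seqs (map (\<lambda>q. Put (cell b (d * (c' + 1)) q) (block_expr k d c c' b q)) (rev [0..<j])))
      (f, partial_mem k d c c' n M ((b * n + i) * (d * (c' + 1)) + j)) =
    (f, partial_mem k d c c' n M ((b * n + i) * (d * (c' + 1))))"
  using assms(5)
proof (induction j)
  case (Suc j)
  then have "j < d * (c' + 1)" by simp
  from den_Put_block[OF assms(1-4) this assms(6,7)] Suc.IH Suc.prems
  show ?case by (simp only: upt_Suc_append rev_append rev.simps append.simps list.map seqs_simps den.simps(5))
qed simp

lemma den_rewrite_block:
  assumes "c \<le> c'" "2 * k * n * (d * (c' + 1)) \<le> 2 ^ w" "b < 2 * k" "f 0 = n"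
  shows "den w (rewrite_block k d c c' b) (f, partial_mem k d c c' n M (Suc b * n * (d * (c' + 1)))) =
    (f(1 := 0), partial_mem k d c c' n M (b * n * (d * (c' + 1))))"
proof -
  let ?c = "seqs (map (\<lambda>q. Put (cell b (d * (c' + 1)) q) (block_expr k d c c' b q)) (rev [0..<d * (c' + 1)]))"
  \<comment> \<open>With \<open>j\<close> rounds left, the vectors of this block with index at least
    \<open>j\<close> are done. Register 1 is set to \<open>0\<close> only by the last round, so the
    case without any rounds is separate.\<close>
  have "iter (den w ?c) j (f, partial_mem k d c c' n M ((b * n + j) * (d * (c' + 1)))) =
      (if j = 0 then f else f(1 := 0), partial_mem k d c c' n M (b * n * (d * (c' + 1))))"
    if "j \<le> n" "f 0 = n" for j f
    using that
  proof (induction j arbitrary: f)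
    case (Suc j)
    have "den w ?c (f(1 := j), partial_mem k d c c' n M ((b * n + Suc j) * (d * (c' + 1)))) =
        (f(1 := j), partial_mem k d c c' n M ((b * n + j) * (d * (c' + 1))))"
      using den_Put_blocks[OF assms(1-3), of j "d * (c' + 1)" "f(1 := j)" M] Suc.prems
      by (simp add: add.commute)
    moreover have "iter (den w ?c) j (f(1 := j), partial_mem k d c c' n M ((b * n + j) * (d * (c' + 1)))) =
        (if j = 0 then f(1 := j) else f(1 := j, 1 := 0), partial_mem k d c c' n M (b * n * (d * (c' + 1))))"
      using Suc.prems by (intro Suc.IH) auto
    moreover have "(if j = 0 then f(1 := j) else f(1 := j, 1 := 0)) = f(1 := 0)" by simp
    ultimately show ?case by (simp only: iter.simps fst_conv snd_conv nat.distinct if_False)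
  qed simp
  from this[of n "f(1 := n)"] assms(4)
  have *: "iter (den w ?c) n (f(1 := n), partial_mem k d c c' n M ((b * n + n) * (d * (c' + 1)))) =
      (f(1 := 0), partial_mem k d c c' n M (b * n * (d * (c' + 1))))"
    by (auto split: if_splits)
  have "Suc b * n = b * n + n" by simp
  with * show ?thesis
    unfolding rewrite_block_def den.simps fst_conv snd_conv assms(4) by (simp only:)
qed

lemma den_rewrite:
  assumes "c \<le> c'" "2 * k * n * (d * (c' + 1)) \<le> 2 ^ w" "f 0 = n"
  shows "\<exists>f'. den w (rewrite k d c c') (f, M) = (f', new_mem k d c c' n M) \<and> f' 0 = n"
proof -
  have "\<exists>f'. den w (seqs (map (rewrite_block k d c c') (rev [0..<B])))
      (f, partial_mem k d c c' n M (B * n * (d * (c' + 1)))) =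
        (f', partial_mem k d c c' n M 0) \<and> f' 0 = n"
    if "B \<le> 2 * k" "f 0 = n" for B f
    using that
  proof (induction B arbitrary: f)
    case (Suc B)
    then have "B < 2 * k" "B \<le> 2 * k" "(f(1 := 0)) 0 = n" by simp_all
    from den_rewrite_block[where f = f, OF assms(1,2) this(1) Suc.prems(2), of M] Suc.IH[where f = "f(1 := 0)", OF this(2,3)]
    show ?case by (simp only: upt_Suc_append rev_append rev.simps append.simps list.map seqs_simps den.simps(5))
  qed simp
  moreover have "partial_mem k d c c' n M (2 * k * n * (d * (c' + 1))) = M"
    by (auto simp: partial_mem_def new_mem_def fun_eq_iff)
  moreover have "partial_mem k d c c' n M 0 = new_mem k d c c' n M"
    by (auto simp: partial_mem_def fun_eq_iff)
  ultimately show ?thesis using assms(3) by (metis rewrite_def order_refl)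
qed

lemma new_mem_first_tensor:
  assumes "k \<ge> 2" "c \<le> c'" "t < k" "i < 2 * n" "s < d"
    and "stored_at c w M (((t * n + i mod n) * d + s) * (c + 1)) (x t (i mod n) s)"
  shows "stored_at c' w (new_mem k d c c' n M) (((t * (2 * n) + i) * d + s) * (c' + 1))
           (cross_factor (k - 1) n x 0 t i s)"
proof -
  let ?a = "((t * (2 * n) + i) * d + s) * (c' + 1)"
  define b where "b = 2 * t + i div n"
  have n: "0 < n" using assms(4) by (cases n) auto
  have h: "i div n < 2" using assms(4) by (simp add: less_mult_imp_div_less)
  have b: "b < 2 * k" "b div 2 = t" using h assms(3) by (auto simp: b_def)
  have i: "i = i div n * n + i mod n" by simp
  have idx: "t * (2 * n) + i = b * n + i mod n"
    by (subst i) (simp only: b_def algebra_simps)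
  have cell: "new_mem k d c c' n M (?a + e) =
      (if b = 0 \<or> b = 2 * k - 1 \<or> c < e then 0
       else M (((t * n + i mod n) * d + s) * (c + 1) + e))" if "e \<le> c'" for e
  proof -
    have "s * (c' + 1) + e < d * (c' + 1)"
      using cell_bound[of s d 0 1 e "c' + 1"] assms(5) that by simp
    from new_mem_cell[OF b(1) _ this, of "i mod n" n c M] n
    have "new_mem k d c c' n M ((b * n + i mod n) * (d * (c' + 1)) + (s * (c' + 1) + e)) =
      (if is_zero_cell k c c' b (s * (c' + 1) + e) then 0
       else M ((t * n + i mod n) * (d * (c + 1)) + source_offset c c' (s * (c' + 1) + e)))"
      by (simp add: b(2))
    moreover have "?a + e = (b * n + i mod n) * (d * (c' + 1)) + (s * (c' + 1) + e)"
      unfolding idx by (simp only: algebra_simps)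
    moreover have q: "(s * (c' + 1) + e) div (c' + 1) = s" "(s * (c' + 1) + e) mod (c' + 1) = e"
      using that by (simp_all only: div_mult_self3 mod_mult_self3 div_less mod_less less_Suc_eq_le Suc_eq_plus1[symmetric])
    moreover have "((t * n + i mod n) * d + s) * (c + 1) + e =
        (t * n + i mod n) * (d * (c + 1)) + (s * (c + 1) + e)"
      by (simp only: algebra_simps)
    ultimately show ?thesis by (simp only: is_zero_cell_def source_offset_def q)
  qed
  \<comment> \<open>Block 0 is the lower half of the first factor and block \<open>2 * k - 1\<close>
    the upper half of the last one, exactly where \<open>cross_factor\<close> vanishes.\<close>
  have zero: "b = 0 \<or> b = 2 * k - 1 \<longleftrightarrow> t = 0 \<and> i < n \<or> t = k - 1 \<and> n \<le> i"
  proof -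
    have "i div n = 0 \<longleftrightarrow> i < n" using n by (simp add: div_eq_0_iff)
    moreover have "i div n = 1 \<longleftrightarrow> n \<le> i" using calculation h by linarith
    moreover have "b = 2 * k - 1 \<longleftrightarrow> t = k - 1 \<and> i div n = 1"
      using h assms(1,3) unfolding b_def by linarith
    ultimately show ?thesis by (auto simp: b_def)
  qed
  show ?thesis
  proof (cases "b = 0 \<or> b = 2 * k - 1")
    case True
    then have "cross_factor (k - 1) n x 0 t i s = 0" using zero by (auto simp: cross_factor_def)
    then show ?thesis using cell True by (auto intro!: stored_at_zero)
  next
    case False
    then have "cross_factor (k - 1) n x 0 t i s = x t (i mod n) s" using zero by (auto simp: cross_factor_def)
    then show ?thesis using stored_at_extend[OF assms(6,2)] cell False assms(2) by auto
  qed
qed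

section \<open>The program\<close>

lemma seqp_Const: "seqp P [Const r c] = P @ [Const r c]"
  by (simp add: seqp_def)

lemma reach_clear:
  "reach w (map (\<lambda>r. Const r 0) [1..<Suc j]) j (St 0 g M)
     (St j (\<lambda>r. if 1 \<le> r \<and> r \<le> j then 0 else g r) M)"
proof (induction j)
  case (Suc j)
  let ?P = "map (\<lambda>r. Const r 0) [1..<Suc j]"
  let ?g = "\<lambda>r. if 1 \<le> r \<and> r \<le> j then 0 else g r"
  have len: "length ?P = j" by simp
  have "reach w [Const (Suc j) 0] 1 (St 0 ?g M) (St (length [Const (Suc j) 0]) (?g(Suc j := 0)) M)"
    by (auto simp: fun_upd_def intro!: reach_step)
  from reach_seqp_St[of w ?P j g M ?g M, unfolded len, OF Suc.IH this]
  have "reach w (seqp ?P [Const (Suc j) 0]) (Suc j) (St 0 g M) (St (Suc j) (?g(Suc j := 0)) M)"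
    by (simp only: length_seqp len) simp
  moreover have "seqp ?P [Const (Suc j) 0] = map (\<lambda>r. Const r 0) [1..<Suc (Suc j)]"
    by (simp add: seqp_Const)
  moreover have "?g(Suc j := 0) = (\<lambda>r. if 1 \<le> r \<and> r \<le> Suc j then 0 else g r)"
    by (auto simp: fun_eq_iff)
  ultimately show ?case by (simp only:)
next
  case 0
  have "(\<lambda>r. if 1 \<le> r \<and> r \<le> 0 then 0 else g r) = g" by (auto simp: fun_eq_iff)
  then show ?case by simp
qed

text \<open>Recreates the registers of \<open>init\<close> for the doubled size, on which the given
  program will run.\<close>

definition reset :: "nat \<Rightarrow> instr list" where
  "reset B = seqp (map (\<lambda>r. Const r 0) [1..<Suc B]) [Op Add 0 0 0]"

lemma reach_reset:
  assumes "g 0 = n" "2 * n < 2 ^ w" "\<And>r. B < r \<Longrightarrow> g r = 0"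
  shows "reach w (reset B) (length (reset B)) (St 0 g M)
    (St (length (reset B)) ((\<lambda>_. 0)(0 := 2 * n)) M)"
proof -
  let ?g = "\<lambda>r. if 1 \<le> r \<and> r \<le> B then 0 else g r"
  have len: "length (map (\<lambda>r. Const r 0) [1..<Suc B]) = B" by simp
  have *: "reach w [Op Add 0 0 0] 1 (St 0 h M) (St (length [Op Add 0 0 0]) (h(0 := 2 * n)) M)"
    if "(h 0 + h 0) mod 2 ^ w = 2 * n" for h
    using that by (auto intro!: reach_step)
  have "reach w [Op Add 0 0 0] 1 (St 0 ?g M) (St (length [Op Add 0 0 0]) (?g(0 := 2 * n)) M)"
    by (rule *) (use assms(1,2) in \<open>simp add: mult_2\<close>)
  moreover have "?g(0 := 2 * n) = (\<lambda>_. 0)(0 := 2 * n)" using assms(3) by (auto simp: fun_eq_iff)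
  ultimately have "reach w [Op Add 0 0 0] 1 (St 0 ?g M)
      (St (length [Op Add 0 0 0]) ((\<lambda>_. 0)(0 := 2 * n)) M)" by (simp only:)
  from reach_seqp_St[of w "map (\<lambda>r. Const r 0) [1..<Suc B]" B g M ?g M, unfolded len, OF reach_clear this]
  show ?thesis by (simp add: reset_def del: upt_Suc)
qed

text \<open>Tag 3 stands for \<open>- \<infinity>\<close> in \<open>stored_at\<close>, so one cell
  suffices as output of the exceptional case.\<close>

definition branch :: "nat \<Rightarrow> nat \<Rightarrow> instr list" where
  "branch R J = [Const R 0, JmpEq 2 R 5, Const (Suc R) 3, Store R (Suc R), Jmp J]"

lemma reach_branch_0:
  "2 < R \<Longrightarrow> g 2 = 0 \<Longrightarrow> reach w (branch R J) 5 (St 0 g M) (St (length (branch R J)) (g(R := 0)) M)"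
  by (rule reach_mono[of _ _ "Suc (Suc 0)"])
    (auto simp: branch_def fun_upd_def eval_nat_numeral intro!: reach_step)

lemma reach_branch_1:
  "2 < R \<Longrightarrow> g 2 = 1 \<Longrightarrow> 3 < (2::nat) ^ w \<Longrightarrow>
    \<exists>g'. reach w (branch R J) 5 (St 0 g M) (St J g' (M(0 := 3)))"
  by (rule exI[of _ "g(R := 0, Suc R := 3)"], rule reach_mono[of _ _ "Suc (Suc (Suc (Suc (Suc 0))))"])
    (auto simp: branch_def fun_upd_def eval_nat_numeral intro!: reach_step)

lemma halted_seqp: "halted Q \<sigma> \<Longrightarrow> halted (seqp P Q) (advance (length P) \<sigma>)"
  by (simp add: halted_def advance_def)

lemma reach_halted:
  assumes "reach w P t \<sigma> \<sigma>'" "halted P \<sigma>'" "t \<le> T"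
  shows "(step w P ^^ T) \<sigma> = \<sigma>'"
proof -
  obtain u where u: "u \<le> t" "(step w P ^^ u) \<sigma> = \<sigma>'" using assms(1) unfolding reach_def by auto
  have "(step w P ^^ j) \<sigma>' = \<sigma>'" for j
    by (induction j) (use assms(2) in \<open>simp_all add: step_def\<close>)
  moreover have "(step w P ^^ T) \<sigma> = (step w P ^^ (T - u)) ((step w P ^^ u) \<sigma>)"
    using u(1) assms(3) by (metis comp_apply funpow_add le_add_diff_inverse2 le_trans)
  ultimately show ?thesis using u(2) by simp
qed

lemma init_St: "init n M = St 0 ((\<lambda>_. 0)(0 := n)) M"
  by (simp add: init_def)

text \<open>The new weights are bounded by \<open>d * W ^ k\<close>: \<open>c * k\<close> words hold
  \<open>W ^ k\<close>, and \<open>d\<close> further words are ample for the factor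
  \<open>d\<close>.\<close>

locale reduction =
  fixes k d c c' :: nat and bs :: "nat list list" and P :: "instr list"
  assumes k: "2 \<le> k" and d: "1 \<le> d" and c: "c' = c * k + d"
    and bs: "set bs = bad_types k d"
begin

definition "free_reg = 3 + k * 6 ^ d"
definition "front = compile free_reg (Seq (detect k d c) (judge k d bs))"
definition "back = compile free_reg (rewrite k d c c')"
text \<open>\<open>Suc free_reg\<close> is included because \<open>branch\<close> writes to
  it.\<close>

definition "max_reg = (SOME max_reg. Suc free_reg \<le> max_reg \<and> (\<forall>I\<in>set front \<union> set back. \<forall>r\<in>target I. r \<le> max_reg))"
text \<open>Counted from the start of \<open>branch\<close>, whose length is 5; relocation behind
  \<open>front\<close> turns it into the address just past the whole program.\<close>

definition "exit_pc = length back + length (reset max_reg) + length P + 5"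
definition "prefix = seqp front (seqp (branch free_reg exit_pc) (seqp back (reset max_reg)))"
definition "program = seqp prefix P"
definition "time n = cost free_reg n (Seq (detect k d c) (judge k d bs)) + (5 + (cost free_reg n (rewrite k d c c') + length (reset max_reg)))"
text \<open>The summands make room in a word for the types, for the addresses of the rewritten cells
  and for the tag 3.\<close>

definition "size_const = 6 ^ d + 2 * k * (d * (c' + 1)) + 3"

lemma max_reg: "Suc free_reg \<le> max_reg" "I \<in> set front \<union> set back \<Longrightarrow> r \<in> target I \<Longrightarrow> r \<le> max_reg"
proof -
  obtain B1 B2 where "\<forall>I\<in>set front. \<forall>r\<in>target I. r < B1" "\<forall>I\<in>set back. \<forall>r\<in>target I. r < B2"
    using targets_bounded by meson
  then have "Suc free_reg \<le> max (Suc free_reg) (max B1 B2) \<and>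
      (\<forall>I\<in>set front \<union> set back. \<forall>r\<in>target I. r \<le> max (Suc free_reg) (max B1 B2))" by fastforce
  from someI[of "\<lambda>max_reg. Suc free_reg \<le> max_reg \<and> (\<forall>I\<in>set front \<union> set back. \<forall>r\<in>target I. r \<le> max_reg)", OF this]
  show "Suc free_reg \<le> max_reg" "I \<in> set front \<union> set back \<Longrightarrow> r \<in> target I \<Longrightarrow> r \<le> max_reg"
    unfolding max_reg_def[symmetric] by blast+
qed

lemma c_le: "c \<le> c'"
proof -
  have "c * 1 \<le> c * k" using k by (intro mult_left_mono) auto
  then show ?thesis using c by linarith
qed

lemma size_bounds:
  assumes "size_const * (n + 1) < 2 ^ w"
  shows "(6::nat) ^ d \<le> 2 ^ w" "k * n * d * (c + 1) \<le> 2 ^ w" "2 * k * n * (d * (c' + 1)) \<le> 2 ^ w"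
    "2 * n < 2 ^ w" "3 < (2::nat) ^ w" "0 < w"
proof -
  have le: "x * y < 2 ^ w" if "x \<le> size_const" "y \<le> n + 1" for x y
    using mult_le_mono[OF that] assms by linarith
  show "(6::nat) ^ d \<le> 2 ^ w" using le[of "6 ^ d" 1] by (simp add: size_const_def)
  have "2 * k * (d * (c' + 1)) * n < 2 ^ w" by (rule le) (auto simp: size_const_def)
  moreover have "2 * k * (d * (c' + 1)) * n = 2 * k * n * (d * (c' + 1))" by (simp only: ac_simps)
  ultimately show 2: "2 * k * n * (d * (c' + 1)) \<le> 2 ^ w" by (metis less_imp_le)
  have "k * n * d * (c + 1) \<le> k * n * d * (c' + 1)" using c_le by (intro mult_left_mono) auto
  also have "\<dots> \<le> 2 * k * n * (d * (c' + 1))" by (simp add: algebra_simps)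
  finally show "k * n * d * (c + 1) \<le> 2 ^ w" using 2 by linarith
  show "2 * n < 2 ^ w" by (rule le) (auto simp: size_const_def)
  have "(3 + 1) * 1 < (2::nat) ^ w" by (rule le) (auto simp: size_const_def Suc_le_eq)
  then show "3 < (2::nat) ^ w" by simp
  then show "0 < w" by (cases w) auto
qed

lemma reach_front:
  assumes "size_const * (n + 1) < 2 ^ w"
    and "\<And>t i. t < k \<Longrightarrow> i < n \<Longrightarrow> vector_type d c n M t i < 6 ^ d"
  shows "\<exists>g. reach w front (cost free_reg n (Seq (detect k d c) (judge k d bs))) (init n M) (St (length front) g M) \<and>
    g 0 = n \<and> (\<forall>r>max_reg. g r = 0) \<and>
    g 2 = (if \<exists>\<tau>s\<in>bad_types k d. \<forall>t<k. \<exists>i<n. vector_type d c n M t i = \<tau>s ! t then 1 else 0)"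
proof -
  note sb = size_bounds[OF assms(1)]
  let ?f = "(\<lambda>_. 0)(0 := n) :: nat \<Rightarrow> nat"
  let ?c = "Seq (detect k d c) (judge k d bs)"
  obtain f' where f': "den w ?c (?f, M) = (f', M)" "f' 0 = n"
    "f' 2 = (if \<exists>\<tau>s\<in>bad_types k d. \<forall>t<k. \<exists>i<n. vector_type d c n M t i = \<tau>s ! t then 1 else 0)"
    using den_detect_judge[of w d k n c ?f M bs, OF sb(6,1,2) _ _ assms(2) bs] by auto
  have "wf_cmd free_reg ?c" using wf_detect wf_judge[of k d free_reg bs] bs by (auto simp: free_reg_def bad_types_def)
  then obtain g where g: "reach w front (cost free_reg n ?c) (St 0 ?f M) (St (length front) g M)"
    "\<forall>v<free_reg. g v = f' v"
    using compile_correct[of free_reg ?c w ?f ?f M] sb(4,6) f'(1) by (auto simp: front_def free_reg_def)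
  have "g r = 0" if "max_reg < r" for r
    using regs_reach_other[OF _ g(1), of r] max_reg(2)[of _ r] that by fastforce
  then show ?thesis using g f' by (intro exI[of _ g]) (auto simp: init_St free_reg_def)
qed

lemma reach_prefix:
  assumes "size_const * (n + 1) < 2 ^ w"
    and "\<And>t i. t < k \<Longrightarrow> i < n \<Longrightarrow> vector_type d c n M t i < 6 ^ d"
    and "\<not> (\<exists>\<tau>s\<in>bad_types k d. \<forall>t<k. \<exists>i<n. vector_type d c n M t i = \<tau>s ! t)"
  shows "reach w prefix (time n) (init n M)
    (advance (length prefix) (init (2 * n) (new_mem k d c c' n M)))"
proof -
  note sb = size_bounds[OF assms(1)]
  let ?M = "new_mem k d c c' n M"
  obtain g where g: "reach w front (cost free_reg n (Seq (detect k d c) (judge k d bs))) (init n M) (St (length front) g M)"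
      "g 0 = n" "\<forall>r>max_reg. g r = 0" "g 2 = 0"
    using reach_front[OF assms(1,2)] assms(3) by auto
  have "2 < free_reg" by (simp add: free_reg_def)
  from reach_branch_0[where g = g, OF this g(4)]
  have br: "reach w (branch free_reg exit_pc) 5 (St 0 g M) (St (length (branch free_reg exit_pc)) (g(free_reg := 0)) M)" .
  have g0: "(g(free_reg := 0)) 0 = n" using g(2) by (simp add: free_reg_def)
  obtain f' where f': "den w (rewrite k d c c') (g(free_reg := 0), M) = (f', ?M)" "f' 0 = n"
    using den_rewrite[where f = "g(free_reg := 0)", OF c_le sb(3) g0] by blast
  obtain g3 where g3: "reach w back (cost free_reg n (rewrite k d c c')) (St 0 (g(free_reg := 0)) M) (St (length back) g3 ?M)"
      "\<forall>v<free_reg. g3 v = f' v"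
    using compile_correct[of free_reg "rewrite k d c c'" w "g(free_reg := 0)" "g(free_reg := 0)" M] wf_rewrite[of free_reg] sb(4,6) f'(1) g0
    by (auto simp: back_def free_reg_def)
  have "g3 r = 0" if "max_reg < r" for r
  proof -
    have "g3 r = (g(free_reg := 0)) r"
      using regs_reach_other[OF _ g3(1), of r] max_reg(2)[of _ r] that by fastforce
    then show ?thesis using g(3) that by simp
  qed
  moreover have "g3 0 = n" using g3(2) f'(2) by (simp add: free_reg_def)
  ultimately have "reach w (reset max_reg) (length (reset max_reg)) (St 0 g3 ?M)
      (St (length (reset max_reg)) ((\<lambda>_. 0)(0 := 2 * n)) ?M)"
    using sb(4) by (intro reach_reset) auto
  from reach_seqp_St[OF g(1)[unfolded init_St] reach_seqp_St[OF br reach_seqp_St[OF g3(1) this]]]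
  show ?thesis by (simp add: prefix_def time_def init_St)
qed

lemma program_bad:
  assumes "size_const * (n + 1) < 2 ^ w"
    and "\<And>t i. t < k \<Longrightarrow> i < n \<Longrightarrow> vector_type d c n M t i < 6 ^ d"
    and "\<exists>\<tau>s\<in>bad_types k d. \<forall>t<k. \<exists>i<n. vector_type d c n M t i = \<tau>s ! t"
  shows "\<exists>\<sigma>. reach w program (time n) (init n M) \<sigma> \<and> halted program \<sigma> \<and> mem \<sigma> 0 = 3"
proof -
  note sb = size_bounds[OF assms(1)]
  obtain g where g: "reach w front (cost free_reg n (Seq (detect k d c) (judge k d bs))) (init n M) (St (length front) g M)"
      "g 2 = 1"
    using reach_front[OF assms(1,2)] assms(3) by auto
  have "2 < free_reg" by (simp add: free_reg_def)
  from reach_branch_1[where g = g, OF this g(2) sb(5)]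
  obtain g' where "reach w (branch free_reg exit_pc) 5 (St 0 g M) (St exit_pc g' (M(0 := 3)))" by blast
  from reach_seqp1[OF reach_seqp[OF g(1)[unfolded init_St] reach_seqp1[OF this]]]
  have "reach w program (cost free_reg n (Seq (detect k d c) (judge k d bs)) + 5) (init n M)
      (St (exit_pc + length front) g' (M(0 := 3)))"
    by (simp add: program_def prefix_def init_St)
  then have "reach w program (time n) (init n M) (St (exit_pc + length front) g' (M(0 := 3)))"
    by (rule reach_mono) (simp add: time_def)
  moreover have "halted program (St (exit_pc + length front) g' (M(0 := 3)))"
    by (simp add: halted_def program_def prefix_def exit_pc_def branch_def)
  ultimately show ?thesis by (intro exI[of _ "St (exit_pc + length front) g' (M(0 := 3))"]) simp
qed

lemma program_good:
  assumes "size_const * (n + 1) < 2 ^ w"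
    and "\<And>t i. t < k \<Longrightarrow> i < n \<Longrightarrow> vector_type d c n M t i < 6 ^ d"
    and "\<not> (\<exists>\<tau>s\<in>bad_types k d. \<forall>t<k. \<exists>i<n. vector_type d c n M t i = \<tau>s ! t)"
    and "halted P ((step w P ^^ T) (init (2 * n) (new_mem k d c c' n M)))"
  shows "\<exists>\<sigma>. reach w program (time n + T) (init n M) \<sigma> \<and> halted program \<sigma> \<and>
    mem \<sigma> = mem ((step w P ^^ T) (init (2 * n) (new_mem k d c c' n M)))"
proof -
  let ?\<sigma> = "(step w P ^^ T) (init (2 * n) (new_mem k d c c' n M))"
  have "reach w P T (init (2 * n) (new_mem k d c c' n M)) ?\<sigma>" unfolding reach_def by blast
  from reach_seqp[OF reach_prefix[OF assms(1-3), unfolded init_St advance_St add_0] this[unfolded init_St]]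
  have "reach w program (time n + T) (init n M) (advance (length prefix) ?\<sigma>)"
    by (simp add: program_def init_St)
  then show ?thesis
    using halted_seqp[OF assms(4), of prefix]
    by (intro exI[of _ "advance (length prefix) ?\<sigma>"]) (simp add: program_def advance_def)
qed

lemma new_mem_ge: "2 * k * n * (d * (c' + 1)) \<le> a \<Longrightarrow> new_mem k d c c' n M a = M a"
  by (simp add: new_mem_def)

lemma new_mem_less: "(\<And>a. M a < 2 ^ w) \<Longrightarrow> new_mem k d c c' n M a < 2 ^ w"
  by (simp add: new_mem_def Let_def)

text \<open>The absence of \<open>- \<infinity>\<close> among the inner products is what makes every
  crossing weight admissible; all other weights are zero.\<close>

lemma lws_instance:
  assumes n: "1 \<le> n" and W: "W < 2 ^ (c * w)" "0 < w"
    and x: "\<And>t i s. t < k \<Longrightarrow> i < n \<Longrightarrow> s < d \<Longrightarrow> x t i s \<in> weights W \<and>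
           stored_at c w M (((t * n + i) * d + s) * (c + 1)) (x t i s)"
    and M: "input_memory w (k * n * d * (c + 1)) M"
    and fin: "\<And>is. is \<in> tuples k n \<Longrightarrow> gip d k (\<lambda>t. x t (is ! t)) \<noteq> - \<infinity>"
  shows "lws_rank_problem (k - 1) d c' (2 * n) w (new_mem k d c c' n M) (kmin_ip k d n x)"
proof -
  let ?m = "k - 1" and ?W = "d * W ^ k" and ?M = "new_mem k d c c' n M"
  have km: "k - 1 + 1 = k" using k by simp
  have "?W < 2 ^ (c' * w)"
  proof -
    have "W ^ k \<le> (2 ^ (c * w)) ^ k" using W by (intro power_mono) auto
    moreover have "d < 2 ^ (d * w)"
      using W(2) by (intro less_le_trans[OF less_exp power_increasing]) (auto simp: Suc_le_eq)
    then have "d * (2 ^ (c * w)) ^ k < 2 ^ (d * w) * (2 ^ (c * w)) ^ k" by simp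
    ultimately have "?W < 2 ^ (d * w) * (2 ^ (c * w)) ^ k" by (meson le_less_trans mult_le_mono2)
    also have "\<dots> = 2 ^ (c' * w)" by (simp add: c power_mult power_add algebra_simps flip: power_mult power_add)
    finally show ?thesis .
  qed
  \<comment> \<open>Tensor entries and factors share one bound, so the factors have to fit under the
    bound for inner products.\<close>
  moreover have "W \<le> ?W"
  proof -
    have "W * 1 \<le> W * (d * W ^ (k - 1))" by (cases "W = 0") (use d in \<open>auto intro!: mult_left_mono simp: Suc_le_eq\<close>)
    then show ?thesis using k by (simp add: power_eq_if algebra_simps)
  qed
  then have factors: "cross_factor ?m n x l t i s \<in> weights ?W" if "t < k" "s < d" for l t i s
    using x[of t "i mod n" s] that n by (auto simp: cross_factor_def intro: weights_mono)
  have "cross_weight ?m n d x l js \<in> weights ?W" if js: "js \<in> tuples k (2 * n)" for l js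
  proof (cases "l \<noteq> 0 \<or> js ! 0 < n \<or> n \<le> js ! ?m")
    case True
    then show ?thesis by (simp add: cross_weight_eq_0)
  next
    case False
    have "length js = k" using js by (simp add: tuples_def)
    then have *: "map (\<lambda>i. i mod n) js \<in> tuples k n" using n by (intro map_mod_tuples) auto
    have "cross_weight ?m n d x l js = gip d k (\<lambda>t. x t (map (\<lambda>i. i mod n) js ! t))"
      using False cross_weight_crossing[of n js ?m d x] \<open>length js = k\<close> km by auto
    also have "\<dots> \<in> weights ?W"
      using x tuples_nth[OF *] fin[OF *] by (intro weights_gip) auto
    finally show ?thesis .
  qed
  moreover have "stored_at c' w ?M ((((l * k + t) * (2 * n) + i) * d + s) * (c' + 1)) (cross_factor ?m n x l t i s)"
    if "t < k" "i < 2 * n" "s < d" for l t i s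
  proof (cases "l = 0")
    case True
    have "i mod n < n" using n by simp
    then show ?thesis
      using new_mem_first_tensor[OF k c_le that, where x = x] x[of t "i mod n" s] that True by simp
  next
    case False
    let ?a = "(((l * k + t) * (2 * n) + i) * d + s) * (c' + 1)"
    \<comment> \<open>The factors of a later tensor are stored behind those of the first, past all
      rewritten cells and past the old input; the zeros found there encode the number zero.\<close>
    have "1 * k * (2 * n) * (d * (c' + 1)) \<le> l * k * (2 * n) * (d * (c' + 1))"
      using False by (intro mult_right_mono) auto
    also have "\<dots> \<le> ?a" by (simp add: algebra_simps)
    finally have ge: "2 * k * n * (d * (c' + 1)) \<le> ?a" by (simp add: algebra_simps)
    have "k * n * d * (c + 1) \<le> k * n * d * (c' + 1)" using c_le by (intro mult_left_mono) auto
    also have "\<dots> \<le> 2 * k * n * (d * (c' + 1))" by (simp add: algebra_simps)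
    finally have "M (?a + e) = 0" for e using M ge by (auto simp: input_memory_def)
    then have "?M (?a + e) = 0" for e using ge new_mem_ge[of n "?a + e" M] by simp
    then have "stored_at c' w ?M ?a 0" by (intro stored_at_zero)
    then show ?thesis using False by (simp add: cross_factor_def)
  qed
  moreover have "input_memory w (?m * k * (2 * n) * d * (c' + 1)) ?M"
  proof -
    have "?M a = 0" if "?m * k * (2 * n) * d * (c' + 1) \<le> a" for a
    proof -
      have "1 * (2 * k * n * (d * (c' + 1))) \<le> ?m * (2 * k * n * (d * (c' + 1)))"
        using k by (intro mult_right_mono) auto
      also have "\<dots> = ?m * k * (2 * n) * d * (c' + 1)" by (simp only: ac_simps)
      finally have ge: "2 * k * n * (d * (c' + 1)) \<le> a" using that by simp
      have "k * n * d * (c + 1) \<le> k * n * d * (c' + 1)" using c_le by (intro mult_left_mono) auto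
      also have "\<dots> \<le> 2 * k * n * (d * (c' + 1))" by (simp add: algebra_simps)
      finally show ?thesis using M ge new_mem_ge[OF ge] by (auto simp: input_memory_def)
    qed
    then show ?thesis using M new_mem_less[of M w] by (auto simp: input_memory_def)
  qed
  moreover have "kmin_ip k d n x = lws ?m (2 * n) (cross_weight ?m n d x)"
    using lws_cross_weight[of ?m n d x] k n km by simp
  moreover have "rank_factors k (2 * n) d (cross_weight ?m n d x l) (cross_factor ?m n x l)" for l
    by (simp add: rank_factors_def cross_weight_def km del: One_nat_def)
  ultimately show ?thesis
    unfolding lws_rank_problem_def km using factors
    by (intro exI[of _ ?W] exI[of _ "cross_weight ?m n d x"] exI[of _ "cross_factor ?m n x"]) auto
qed

text \<open>Both cases share the time \<open>time n + T\<close>: after an early exit the machine is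
  halted and its state no longer changes.\<close>

lemma program_correct:
  assumes n: "1 \<le> n" and size: "size_const * (n + 1) < 2 ^ w"
    and prob: "kmin_ip_problem k d c n w M v"
    and P: "\<And>M v. lws_rank_problem (k - 1) d c' (2 * n) w M v \<Longrightarrow>
      halted P ((step w P ^^ T) (init (2 * n) M)) \<and>
      stored_at q w (mem ((step w P ^^ T) (init (2 * n) M))) 0 v"
  shows "let \<sigma> = (step w program ^^ (time n + T)) (init n M)
         in halted program \<sigma> \<and> stored_at q w (mem \<sigma>) 0 v"
proof -
  obtain W x where W: "W < 2 ^ (c * w)"
    and x: "\<And>t i s. t < k \<Longrightarrow> i < n \<Longrightarrow> s < d \<Longrightarrow> x t i s \<in> weights W \<and>
           stored_at c w M (((t * n + i) * d + s) * (c + 1)) (x t i s)"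
    and M: "input_memory w (k * n * d * (c + 1)) M" and v: "v = kmin_ip k d n x"
    using prob unfolding kmin_ip_problem_def by blast
  have x': "x t i s \<noteq> - \<infinity> \<and> stored_at c w M (((t * n + i) * d + s) * (c + 1)) (x t i s)"
    if "t < k" "i < n" "s < d" for t i s
    using x[OF that] by (auto simp: weights_iff)
  have type: "vector_type d c n M t i < 6 ^ d" if "t < k" "i < n" for t i
    using vector_type_less_same_sign(1)[of d "x t i"] x' that by blast
  note iff = ex_MInfty_iff_bad_types[of k n d x c w M, OF x']
  show ?thesis
  proof (cases "\<exists>is\<in>tuples k n. gip d k (\<lambda>t. x t (is ! t)) = - \<infinity>")
    case True
    then obtain "is" where "is \<in> tuples k n" "gip d k (\<lambda>t. x t (is ! t)) = - \<infinity>" by blast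
    then have "kmin_ip k d n x \<le> - \<infinity>"
      unfolding kmin_ip_def by (metis (no_types, lifting) Min_le finite_imageI finite_tuples imageI)
    then have "v = - \<infinity>" using v by simp
    moreover obtain \<sigma> where "reach w program (time n) (init n M) \<sigma>" "halted program \<sigma>" "mem \<sigma> 0 = 3"
      using program_bad[OF size type] True iff by blast
    ultimately show ?thesis
      using reach_halted[of w program "time n" "init n M" \<sigma> "time n + T"] by (simp add: stored_at_def)
  next
    case False
    have "lws_rank_problem (k - 1) d c' (2 * n) w (new_mem k d c c' n M) v"
      unfolding v by (rule lws_instance[OF n W size_bounds(6)[OF size] x M]) (use False in auto)
    note P = P[OF this]
    obtain \<sigma> where "reach w program (time n + T) (init n M) \<sigma>" "halted program \<sigma>"
        "mem \<sigma> = mem ((step w P ^^ T) (init (2 * n) (new_mem k d c c' n M)))"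
      using program_good[OF size type] False iff P by blast
    then show ?thesis
      using P reach_halted[of w program "time n + T" "init n M" \<sigma> "time n + T"] by simp
  qed
qed

lemma time_affine: "\<exists>A B. \<forall>n. time n \<le> A * n + B"
proof -
  obtain A1 B1 A2 B2 where
    "\<forall>n. cost free_reg n (Seq (detect k d c) (judge k d bs)) \<le> A1 * n + B1"
    "\<forall>n. cost free_reg n (rewrite k d c c') \<le> A2 * n + B2"
    using cost_affine by meson
  note bounds = this
  have "time n \<le> (A1 + A2) * n + (B1 + B2 + 5 + length (reset max_reg))" for n
    using bounds(1)[rule_format, of n] bounds(2)[rule_format, of n]
    unfolding time_def distrib_right by linarith
  then show ?thesis by blast
qed

end

text \<open>As the logarithm is at least 1, the word size is at least \<open>K\<close> plus the
  logarithm of \<open>n + 1\<close>, and \<open>K < 2 ^ K\<close>.\<close>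

lemma word_size_bound:
  assumes "(real K + 1) * log 2 (real n + 1) \<le> real w" "1 \<le> n"
  shows "K * (n + 1) < 2 ^ w"
proof -
  have "1 \<le> log 2 (real n + 1)" using assms(2) by (simp add: le_log_iff)
  then have "real K * 1 \<le> real K * log 2 (real n + 1)" by (intro mult_left_mono) auto
  then have "real K + log 2 (real n + 1) \<le> real w" using assms(1) by (simp add: algebra_simps)
  then have "2 powr (real K + log 2 (real n + 1)) \<le> 2 powr real w" by simp
  then have "2 ^ K * (real n + 1) \<le> 2 ^ w" by (simp add: powr_add powr_realpow)
  then have "real (2 ^ K * (n + 1)) \<le> real (2 ^ w)"
    by (simp only: of_nat_mult of_nat_power of_nat_add of_nat_numeral of_nat_1)
  then have "2 ^ K * (n + 1) \<le> 2 ^ w" by (simp only: of_nat_le_iff)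
  moreover have "K * (n + 1) < 2 ^ K * (n + 1)" using less_exp[of K] by (intro mult_strict_right_mono) auto
  ultimately show ?thesis by linarith
qed

text \<open>Doubling the size changes a power by a constant factor only, and an exponent of at least
  1 absorbs the linear overhead.\<close>

lemma running_time_bigo:
  assumes "(\<lambda>n. real (T n)) \<in> O(\<lambda>n. real n powr (a - \<epsilon>))" "\<delta> \<le> \<epsilon>" "1 \<le> a - \<delta>"
    and "\<And>n. t n \<le> A * n + B"
  shows "(\<lambda>n. real (t n + T (2 * n))) \<in> O(\<lambda>n. real n powr (a - \<delta>))"
proof -
  have lim: "filterlim (\<lambda>n. 2 * n :: nat) sequentially sequentially"
    by (rule filterlim_subseq) (auto simp: strict_mono_def)
  have "(\<lambda>n. real (T (2 * n))) \<in> O(\<lambda>n. real (2 * n) powr (a - \<epsilon>))"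
    by (rule landau_o.big.compose[OF assms(1) lim])
  also have "(\<lambda>n. real (2 * n) powr (a - \<epsilon>)) = (\<lambda>n. 2 powr (a - \<epsilon>) * real n powr (a - \<epsilon>))"
    by (simp add: powr_mult)
  also have "O(\<dots>) = O(\<lambda>n. real n powr (a - \<epsilon>))" by simp
  finally have T: "(\<lambda>n. real (T (2 * n))) \<in> O(\<lambda>n. real n powr (a - \<epsilon>))" .
  have "(\<lambda>n. real n powr (a - \<epsilon>)) \<in> O(\<lambda>n. real n powr (a - \<delta>))"
  proof (rule landau_o.bigI[of 1])
    show "\<forall>\<^sub>F n in sequentially. norm (real n powr (a - \<epsilon>)) \<le> 1 * norm (real n powr (a - \<delta>))"
      using eventually_ge_at_top[of 1] by eventually_elim (use assms(2) in \<open>auto intro!: powr_mono\<close>)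
  qed simp
  with T have T': "(\<lambda>n. real (T (2 * n))) \<in> O(\<lambda>n. real n powr (a - \<delta>))"
    by (rule landau_o.big_trans)
  have "(\<lambda>n. real (t n)) \<in> O(\<lambda>n. real n powr (a - \<delta>))"
  proof (rule landau_o.bigI[of "real (A + B + 1)"])
    show "\<forall>\<^sub>F n in sequentially. norm (real (t n)) \<le> real (A + B + 1) * norm (real n powr (a - \<delta>))"
      using eventually_ge_at_top[of 1]
    proof eventually_elim
      case (elim n)
      have "B \<le> B * n" using elim by (cases n) auto
      then have "t n \<le> A * n + B * n + n" using assms(4)[of n] by linarith
      then have "t n \<le> (A + B + 1) * n" by (simp add: algebra_simps)
      then have "real (t n) \<le> real (A + B + 1) * real n" by (metis of_nat_le_iff of_nat_mult)
      also have "real n = real n powr 1" using elim by simp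
      also have "\<dots> \<le> real n powr (a - \<delta>)" using elim assms(3) by (intro powr_mono) auto
      finally show ?case by (simp add: mult_left_mono)
    qed
  qed simp
  with T' show ?thesis by (auto intro: sum_in_bigo)
qed

theorem theorem3p1:
  fixes k d :: nat
  assumes "k \<ge> 2" and "d \<ge> 1"
    and "\<exists>\<epsilon>>0. \<forall>c\<ge>1. has_algorithm (lws_rank_problem (k - 1) d c) (real k - \<epsilon>)"
  shows "\<exists>\<delta>>0. \<forall>c\<ge>1. has_algorithm (kmin_ip_problem k d c) (real k - \<delta>)"
proof -
  obtain \<epsilon> where \<epsilon>: "\<epsilon> > 0" "\<forall>c\<ge>1. has_algorithm (lws_rank_problem (k - 1) d c) (real k - \<epsilon>)"
    using assms(3) by blast
  \<comment> \<open>The cap at 1 keeps the exponent \<open>k - \<delta>\<close> at least 1, so that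
    linear preprocessing is affordable. \<open>\<epsilon>\<close> is fixed before \<open>c\<close>,
    hence \<open>\<delta>\<close> does not depend on \<open>c\<close> although the LWS algorithm is
    invoked for \<open>c'\<close>.\<close>
  define \<delta> where "\<delta> = min \<epsilon> 1"
  have "has_algorithm (kmin_ip_problem k d c) (real k - \<delta>)" for c
  proof -
    define c' where "c' = c * k + d"
    have "1 \<le> c'" using assms(2) by (simp add: c'_def)
    then have "has_algorithm (lws_rank_problem (k - 1) d c') (real k - \<epsilon>)" using \<epsilon>(2) by blast
    then obtain P q and c1 :: real where c1: "c1 \<ge> 1" and P: "\<forall>C. \<exists>T :: nat \<Rightarrow> nat.
        (\<lambda>n. real (T n)) \<in> O(\<lambda>n. real n powr (real k - \<epsilon>)) \<and>
        (\<forall>n\<ge>1. \<forall>w. c1 * log 2 (real n + 1) \<le> real w \<and> real w \<le> C * log 2 (real n + 1) \<longrightarrow>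
           (\<forall>M v. lws_rank_problem (k - 1) d c' n w M v \<longrightarrow>
              (let \<sigma> = (step w P ^^ T n) (init n M)
               in halted P \<sigma> \<and> stored_at q w (mem \<sigma>) 0 v)))"
      unfolding has_algorithm_def by (elim exE conjE)
    have "finite (bad_types k d)" by (simp add: bad_types_def)
    then obtain bs where bs: "set bs = bad_types k d" using finite_list by blast
    interpret reduction k d c c' bs P
      by standard (use assms bs c'_def in auto)
    obtain A B where time: "\<And>n. time n \<le> A * n + B" using time_affine by blast
    \<comment> \<open>The first summand covers the doubled size, whose logarithm is at most twice as
      large; the second is the demand of \<open>word_size_bound\<close>.\<close>
    define c0 where "c0 = 2 * c1 + (real size_const + 1)"
    show ?thesis unfolding has_algorithm_def
    proof (intro exI[of _ program] exI[of _ q] exI[of _ c0] conjI allI)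
      show "1 \<le> c0" using c1 by (simp add: c0_def)
    next
      fix C :: real
      \<comment> \<open>The upper bound on the word size refers to \<open>n\<close>, but
        \<open>P\<close> runs at size \<open>2 * n\<close>. With the absolute value the larger
        logarithm may be substituted whatever the sign of \<open>C\<close>.\<close>
      from P[rule_format, of "\<bar>C\<bar>"] obtain T :: "nat \<Rightarrow> nat"
        where T: "(\<lambda>n. real (T n)) \<in> O(\<lambda>n. real n powr (real k - \<epsilon>))"
          and T_correct: "\<forall>n\<ge>1. \<forall>w. c1 * log 2 (real n + 1) \<le> real w \<and>
            real w \<le> \<bar>C\<bar> * log 2 (real n + 1) \<longrightarrow>
           (\<forall>M v. lws_rank_problem (k - 1) d c' n w M v \<longrightarrow>
              (let \<sigma> = (step w P ^^ T n) (init n M)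
               in halted P \<sigma> \<and> stored_at q w (mem \<sigma>) 0 v))"
        by (elim exE conjE)
      show "\<exists>T. (\<lambda>n. real (T n)) \<in> O(\<lambda>n. real n powr (real k - \<delta>)) \<and>
          (\<forall>n\<ge>1. \<forall>w. c0 * log 2 (real n + 1) \<le> real w \<and> real w \<le> C * log 2 (real n + 1) \<longrightarrow>
             (\<forall>M v. kmin_ip_problem k d c n w M v \<longrightarrow>
                (let \<sigma> = (step w program ^^ T n) (init n M)
                 in halted program \<sigma> \<and> stored_at q w (mem \<sigma>) 0 v)))"
      proof (intro exI[of _ "\<lambda>n. time n + T (2 * n)"] conjI allI impI)
        show "(\<lambda>n. real (time n + T (2 * n))) \<in> O(\<lambda>n. real n powr (real k - \<delta>))"
          by (rule running_time_bigo[OF T _ _ time]) (use assms(1) in \<open>auto simp: \<delta>_def\<close>)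
      next
        fix n w :: nat and M v
        assume n: "1 \<le> n" and prob: "kmin_ip_problem k d c n w M v"
          and w: "c0 * log 2 (real n + 1) \<le> real w \<and> real w \<le> C * log 2 (real n + 1)"
        let ?L = "log 2 (real n + 1)" and ?L' = "log 2 (real (2 * n) + 1)"
        have L: "1 \<le> ?L" using n by (simp add: le_log_iff)
        have "?L' \<le> log 2 (2 * (real n + 1))" by simp
        also have "\<dots> = 1 + ?L" by (subst log_mult) auto
        finally have L': "?L' \<le> 2 * ?L" using L by linarith
        have "?L \<le> ?L'" by simp
        have c0: "c0 * ?L = 2 * c1 * ?L + (real size_const + 1) * ?L"
          by (simp add: c0_def algebra_simps)
        have "0 \<le> c1 * ?L" using c1 L by simp
        then have "(real size_const + 1) * ?L \<le> real w" using w c0 by linarith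
        then have size: "size_const * (n + 1) < 2 ^ w" using word_size_bound n by blast
        have "c1 * ?L' \<le> c1 * (2 * ?L)" using L' c1 by (intro mult_left_mono) auto
        moreover have "0 \<le> (real size_const + 1) * ?L" using L by simp
        ultimately have low: "c1 * ?L' \<le> real w" using w c0 by linarith
        have "C * ?L \<le> \<bar>C\<bar> * ?L" using L by (intro mult_right_mono) auto
        also have "\<dots> \<le> \<bar>C\<bar> * ?L'" using \<open>?L \<le> ?L'\<close> by (intro mult_left_mono) auto
        finally have high: "real w \<le> \<bar>C\<bar> * ?L'" using w by linarith
        show "let \<sigma> = (step w program ^^ (time n + T (2 * n))) (init n M)
            in halted program \<sigma> \<and> stored_at q w (mem \<sigma>) 0 v"
        proof (rule program_correct[OF n size prob])
          fix M v assume "lws_rank_problem (k - 1) d c' (2 * n) w M v"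
          moreover have "1 \<le> 2 * n" using n by simp
          ultimately show "halted P ((step w P ^^ T (2 * n)) (init (2 * n) M)) \<and>
              stored_at q w (mem ((step w P ^^ T (2 * n)) (init (2 * n) M))) 0 v"
            using T_correct[rule_format, OF _ conjI[OF low high], unfolded Let_def] by blast
        qed
      qed
    qed
  qed
  moreover have "\<delta> > 0" using \<epsilon>(1) by (simp add: \<delta>_def)
  ultimately show ?thesis by blast
qed

end
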